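(* Assume $\mathrm{W}[1]\neq\mathrm{FPT}$. Then no FPT-time algorithm can approximate $k$-Dominating Set to within a factor of $(\log n)^{1/\mathrm{poly}(k)}$. That is, there is a polynomial $p$ (with $p(k)\ge 1$ for all $k\ge 1$) such that for no computable function $T:\mathbb N\to\mathbb N$ does there exist an algorithm with the following property: on every input $(G,k)$, where $k\geq 1$ is an integer and $G$ is a graph on $n\ge 2$ vertices, it runs in time $T(k)\cdot \mathrm{poly}(n)$ and, whenever the minimum dominating set of $G$ has size at most $k$, it outputs a dominating set of $G$ of size at most $(\log n)^{1/p(k)}\cdot k$.
   Context: Logarithms are base 2. A dominating set of an undirected graph $G$ is a set $S\subseteq V(G)$ such that every vertex outside $S$ has a neighbor in $S$. The hypothesis $\mathrm{W}[1]\ne\mathrm{FPT}$ is used in the following (equivalent) form: for every computable function $T:\mathbb N\to\mathbb N$, no algorithm solves $k$-Clique (given a graph on $n$ vertices and an integer $k$, decide whether the graph contains a clique of size $k$) in time $T(k)\cdot\mathrm{poly}(n)$. *)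

theory Defs
  imports Complex_Main "HOL-Computational_Algebra.Polynomial"
begin

section \<open>Model of computation\<close>

text \<open>
  Algorithms are programs of the language WHILE of N. D. Jones (``Computability and Complexity from
  a Programming Perspective''): finitely many variables ranging over binary trees, where
  every elementary operation and every test costs one unit of time. As trees can be shared in
  memory, each step is realisable in constant time on a pointer machine; time in this model is
  polynomially related to time on Turing machines, so both the computable functions and the time
  bounds of the form T(k) poly(n) with computable T are the usual ones.
\<close>

datatype dtree = Leaf | Node dtree dtree

fun left :: "dtree \<Rightarrow> dtree" where
  "left Leaf = Leaf"
| "left (Node a b) = a"

fun right :: "dtree \<Rightarrow> dtree" where
  "right Leaf = Leaf"
| "right (Node a b) = b"

type_synonym var = nat
type_synonym store = "var \<Rightarrow> dtree"

datatype prog =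
    Skip
  | SetLeaf var
  | Copy var var
  | SetNode var var var
  | SetLeft var var
  | SetRight var var
  | Seq prog prog
  | Cond var prog prog
  | While var prog

text \<open>\<open>exec c s t s'\<close>: program \<open>c\<close> started in store \<open>s\<close> halts after exactly \<open>t\<close> steps in store
  \<open>s'\<close>. In tests, \<open>Leaf\<close> is false and every other tree is true.\<close>

inductive exec :: "prog \<Rightarrow> store \<Rightarrow> nat \<Rightarrow> store \<Rightarrow> bool" where
  Skip: "exec Skip s 1 s"
| SetLeaf: "exec (SetLeaf x) s 1 (s(x := Leaf))"
| Copy: "exec (Copy x y) s 1 (s(x := s y))"
| SetNode: "exec (SetNode x y z) s 1 (s(x := Node (s y) (s z)))"
| SetLeft: "exec (SetLeft x y) s 1 (s(x := left (s y)))"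
| SetRight: "exec (SetRight x y) s 1 (s(x := right (s y)))"
| Seq: "exec c s t s' \<Longrightarrow> exec d s' u s'' \<Longrightarrow> exec (Seq c d) s (t + u) s''"
| CondTrue: "s x \<noteq> Leaf \<Longrightarrow> exec c s t s' \<Longrightarrow> exec (Cond x c d) s (1 + t) s'"
| CondFalse: "s x = Leaf \<Longrightarrow> exec d s t s' \<Longrightarrow> exec (Cond x c d) s (1 + t) s'"
| WhileFalse: "s x = Leaf \<Longrightarrow> exec (While x c) s 1 s"
| WhileTrue: "s x \<noteq> Leaf \<Longrightarrow> exec c s t s' \<Longrightarrow> exec (While x c) s' u s''
    \<Longrightarrow> exec (While x c) s (1 + t + u) s''"

inductive_cases exec_SkipE: "exec Skip s t s'"
inductive_cases exec_SetLeafE: "exec (SetLeaf x) s t s'"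
inductive_cases exec_CopyE: "exec (Copy x y) s t s'"
inductive_cases exec_SetNodeE: "exec (SetNode x y z) s t s'"
inductive_cases exec_SetLeftE: "exec (SetLeft x y) s t s'"
inductive_cases exec_SetRightE: "exec (SetRight x y) s t s'"
inductive_cases exec_SeqE: "exec (Seq c d) s t s'"
inductive_cases exec_CondE: "exec (Cond x c d) s t s'"
inductive_cases exec_WhileE: "exec (While x c) s t s'"

text \<open>Determinism: running time and result of a halting computation are unique, so that they may
  be quantified existentially below.\<close>

lemma exec_deterministic:
  "exec c s t s' \<Longrightarrow> exec c s u s'' \<Longrightarrow> u = t \<and> s'' = s'"
proof (induction arbitrary: u s'' rule: exec.induct)
  case (Skip s) then show ?case by (auto elim: exec_SkipE)
next
  case (SetLeaf x s) then show ?case by (auto elim: exec_SetLeafE)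
next
  case (Copy x y s) then show ?case by (auto elim: exec_CopyE)
next
  case (SetNode x y z s) then show ?case by (auto elim: exec_SetNodeE)
next
  case (SetLeft x y s) then show ?case by (auto elim: exec_SetLeftE)
next
  case (SetRight x y s) then show ?case by (auto elim: exec_SetRightE)
next
  case (Seq c s t s' d v s1)
  from Seq.prems obtain t1 s2 t2 where "exec c s t1 s2" "exec d s2 t2 s''" "u = t1 + t2"
    by (rule exec_SeqE)
  with Seq.IH(1)[of t1 s2] Seq.IH(2)[of t2 s''] show ?case by simp
next
  case (CondTrue s x c t s' d)
  from CondTrue.prems CondTrue.hyps(1) obtain t1 where "exec c s t1 s''" "u = 1 + t1"
    by (auto elim: exec_CondE)
  with CondTrue.IH[of t1 s''] show ?case by simp
next
  case (CondFalse s x d t s' c)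
  from CondFalse.prems CondFalse.hyps(1) obtain t1 where "exec d s t1 s''" "u = 1 + t1"
    by (auto elim: exec_CondE)
  with CondFalse.IH[of t1 s''] show ?case by simp
next
  case (WhileFalse s x c)
  from WhileFalse.prems show ?case by (rule exec_WhileE) (use WhileFalse.hyps in simp_all)
next
  case (WhileTrue s x c t s' v s1)
  from WhileTrue.prems obtain t1 s2 t2 where
    "exec c s t1 s2" "exec (While x c) s2 t2 s''" "u = 1 + t1 + t2"
    by (rule exec_WhileE) (use WhileTrue.hyps(1) in simp_all)
  with WhileTrue.IH(1)[of t1 s2] WhileTrue.IH(2)[of t2 s''] show ?case by simp
qed

text \<open>Input and output are held in variable 0; all other variables are initially \<open>Leaf\<close>.\<close>

definition runs :: "prog \<Rightarrow> dtree \<Rightarrow> nat \<Rightarrow> dtree \<Rightarrow> bool" where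
  "runs P inp t out \<longleftrightarrow> (\<exists>s. exec P ((\<lambda>_. Leaf)(0 := inp)) t s \<and> s 0 = out)"


section \<open>Encodings and computable functions\<close>

fun enc_list :: "dtree list \<Rightarrow> dtree" where
  "enc_list [] = Leaf"
| "enc_list (x # xs) = Node x (enc_list xs)"

text \<open>Numbers are encoded in unary. For vertices this is polynomial in the number of vertices, and
  for the parameter it is a cost depending on the parameter only.\<close>

definition enc_nat :: "nat \<Rightarrow> dtree" where
  "enc_nat m = enc_list (replicate m Leaf)"

definition enc_bool :: "bool \<Rightarrow> dtree" where
  "enc_bool b = (if b then Node Leaf Leaf else Leaf)"

definition computable :: "(nat \<Rightarrow> nat) \<Rightarrow> bool" where
  "computable T \<longleftrightarrow> (\<exists>P. \<forall>k. \<exists>t. runs P (enc_nat k) t (enc_nat (T k)))"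


section \<open>Graphs\<close>

text \<open>A graph on \<open>n\<close> vertices has vertex set \<open>{..<n}\<close>; its edges are two-element sets of
  vertices.\<close>

definition graph :: "nat \<Rightarrow> nat set set \<Rightarrow> bool" where
  "graph n E \<longleftrightarrow> (\<forall>e\<in>E. e \<subseteq> {..<n} \<and> card e = 2)"

definition clique :: "nat \<Rightarrow> nat set set \<Rightarrow> nat set \<Rightarrow> bool" where
  "clique n E S \<longleftrightarrow> S \<subseteq> {..<n} \<and> (\<forall>u\<in>S. \<forall>v\<in>S. u \<noteq> v \<longrightarrow> {u, v} \<in> E)"

definition dominating_set :: "nat \<Rightarrow> nat set set \<Rightarrow> nat set \<Rightarrow> bool" where
  "dominating_set n E S \<longleftrightarrow> S \<subseteq> {..<n} \<and> (\<forall>v\<in>{..<n} - S. \<exists>u\<in>S. {u, v} \<in> E)"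

definition domination_number :: "nat \<Rightarrow> nat set set \<Rightarrow> nat" where
  "domination_number n E = Min (card ` {S. dominating_set n E S})"

text \<open>Graphs are given to programs by their adjacency matrix.\<close>

definition enc_graph :: "nat \<Rightarrow> nat set set \<Rightarrow> dtree" where
  "enc_graph n E =
     enc_list (map (\<lambda>u. enc_list (map (\<lambda>v. enc_bool ({u, v} \<in> E)) [0..<n])) [0..<n])"

definition enc_instance :: "nat \<Rightarrow> nat set set \<Rightarrow> nat \<Rightarrow> dtree" where
  "enc_instance n E k = Node (enc_nat k) (enc_graph n E)"

text \<open>A vertex set may be output as a list of its elements in any order, possibly with
  repetitions.\<close>

definition encodes_vertex_set :: "dtree \<Rightarrow> nat set \<Rightarrow> bool" where
  "encodes_vertex_set out S \<longleftrightarrow> (\<exists>vs. set vs = S \<and> out = enc_list (map enc_nat vs))"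


section \<open>Parameterized problems\<close>

definition solves_clique :: "prog \<Rightarrow> (nat \<Rightarrow> nat) \<Rightarrow> bool" where
  "solves_clique P T \<longleftrightarrow>
     (\<exists>q :: nat poly. \<forall>n E k. graph n E \<longrightarrow>
        (\<exists>t. t \<le> T k * poly q n \<and>
             runs P (enc_instance n E k) t (enc_bool (\<exists>S. clique n E S \<and> card S = k))))"

definition W1_neq_FPT :: bool where
  "W1_neq_FPT \<longleftrightarrow> (\<forall>T. computable T \<longrightarrow> \<not> (\<exists>P. solves_clique P T))"

text \<open>\<open>f n k\<close> is the approximation factor.\<close>

definition approximates_dominating_set ::
  "prog \<Rightarrow> (nat \<Rightarrow> nat) \<Rightarrow> (nat \<Rightarrow> nat \<Rightarrow> real) \<Rightarrow> bool" where
  "approximates_dominating_set P T f \<longleftrightarrow>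
     (\<exists>q :: nat poly. \<forall>n E k. n \<ge> 2 \<and> graph n E \<and> k \<ge> 1 \<longrightarrow>
        (\<exists>t out. t \<le> T k * poly q n \<and> runs P (enc_instance n E k) t out \<and>
           (domination_number n E \<le> k \<longrightarrow>
              (\<exists>S. encodes_vertex_set out S \<and> dominating_set n E S \<and>
                   real (card S) \<le> f n k * real k))))"

end

(* The gap comes from a direct reduction. Guess a clique as k^2 pairs: a vertex (a,b,u,v) selects
   u and v as the a-th and b-th clique vertices, where {u,v} is an edge, or u = v if a = b. For a hash
   function i from the vertices to {0..r} and a map f from {0..r}^k to {0..<k} x {0..<k}, a further
   vertex (i,f) is adjacent to those (a,b,u,v) for which some tuple q has f q = (a,b), q_a = i u and
   q_b = i v. The pairs taken from a clique dominate all (i,f). Conversely, let D be a small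
   dominating set and let i be injective on the vertices of the input graph that occur in D. If every
   tuple q had a cell (a,b) with no compatible pair in D, then a function f choosing such cells would
   give an undominated (i,f); so some q has compatible pairs in all cells, and by injectivity of i
   these are consistent and form a clique. As hash functions, counting the one-bits among r chosen
   binary coordinates suffices: for every set of at most 2h vertices one of them with r = 8h^3 is
   injective, so there are only (log n + 1)^r hash functions and k^(2 (r+1)^k) maps f, which is polynomial
   in n for h = (log n)^(1/O(k^2)) once n is large compared with k. The latter is ensured by padding. *)
theory Submission imports Defs begin

section \<open>Composing programs\<close>

text \<open>The approximation program promises nothing when the domination number exceeds the
  parameter, so its answer is never trusted. Cliques are decided by checking whether the returned
  set dominates and has fewer than \<open>h\<close> elements; acceptance is sound for any set, and
  the guarantee enters only when a clique exists. The exponent must be a polynomial in the parameter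
  of the produced instance, \<open>b = k^2 + 1\<close>. The counts of hash functions and of maps f
  need \<open>L\<close>, about \<open>log N\<close>, to be at least \<open>h^5\<close> and
  \<open>h^(4k+2)\<close>; both follow from \<open>L >= h^(6b+8)\<close>. Twice that exponent,
  \<open>12b + 16\<close>, is the polynomial of the theorem: the doubling makes the approximation
  ratio about the square root of \<open>h\<close>, so that \<open>b\<close> times the ratio stays
  below \<open>h\<close>. The padding depends on \<open>k\<close> alone and is charged to the
  computable factor of the running time. Numbers being unary, \<open>N\<close> is the available
  resource: every enumeration is truncated at \<open>N\<close>, which keeps the construction
  polynomial on all inputs, and the parameter bounds show that nothing needed is cut off.\<close>

primrec vbound :: "prog \<Rightarrow> nat" where
  "vbound Skip = 0"
| "vbound (SetLeaf x) = Suc x"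
| "vbound (Copy x y) = max (Suc x) (Suc y)"
| "vbound (SetNode x y z) = max (Suc x) (max (Suc y) (Suc z))"
| "vbound (SetLeft x y) = max (Suc x) (Suc y)"
| "vbound (SetRight x y) = max (Suc x) (Suc y)"
| "vbound (Seq c d) = max (vbound c) (vbound d)"
| "vbound (Cond x c d) = max (Suc x) (max (vbound c) (vbound d))"
| "vbound (While x c) = max (Suc x) (vbound c)"

text \<open>A program reads and writes only variables below its \<open>vbound\<close>, so a run can
  be transplanted to any store that agrees there, and all other variables stay intact. This lets an
  arbitrary given program run while other variables hold live data.\<close>

lemma exec_frame:
  "exec c s t s' \<Longrightarrow> vbound c \<le> N \<Longrightarrow> (\<And>v. v < N \<Longrightarrow> s v = r v) \<Longrightarrow>
   \<exists>r'. exec c r t r' \<and> (\<forall>v<N. s' v = r' v) \<and> (\<forall>v\<ge>N. r' v = r v)"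
proof (induction arbitrary: r rule: exec.induct)
  case (Skip s) then show ?case using exec.Skip[of r] by blast
next
  case (SetLeaf x s) then show ?case 
    by (intro exI[of _ "r(x := Leaf)"] conjI, intro exec.SetLeaf) auto
next
  case (Copy x y s) then show ?case 
    by (intro exI[of _ "r(x := r y)"] conjI, intro exec.Copy) auto
next
  case (SetNode x y z s) then show ?case 
    by (intro exI[of _ "r(x := Node (r y) (r z))"] conjI, intro exec.SetNode) auto
next
  case (SetLeft x y s) then show ?case 
    by (intro exI[of _ "r(x := left (r y))"] conjI, intro exec.SetLeft) auto
next
  case (SetRight x y s) then show ?case 
    by (intro exI[of _ "r(x := right (r y))"] conjI, intro exec.SetRight) auto
next
  case (Seq c s t s' d u s'')
  from Seq.prems Seq.IH(1)[of r] obtain r1 where 1: "exec c r t r1" "\<forall>v<N. s' v = r1 v" "\<forall>v\<ge>N. r1 v = r v"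
    by auto
  from Seq.prems Seq.IH(2)[of r1] 1 obtain r2 where
    "exec d r1 u r2" "\<forall>v<N. s'' v = r2 v" "\<forall>v\<ge>N. r2 v = r1 v" by auto
  with 1 exec.Seq[of c r t r1 d u r2] show ?case by (intro exI[of _ r2]) auto
next
  case (CondTrue s x c t s' d)
  from CondTrue.prems CondTrue.IH[of r] obtain r1 where 1: "exec c r t r1" "\<forall>v<N. s' v = r1 v" "\<forall>v\<ge>N. r1 v = r v"
    by auto
  have "r x \<noteq> Leaf" using CondTrue.prems(2)[of x] CondTrue.prems(1) CondTrue.hyps by simp
  with 1 show ?case using exec.CondTrue by blast
next
  case (CondFalse s x d t s' c)
  from CondFalse.prems CondFalse.IH[of r] obtain r1 where 1: "exec d r t r1" "\<forall>v<N. s' v = r1 v" "\<forall>v\<ge>N. r1 v = r v"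
    by auto
  have "r x = Leaf" using CondFalse.prems(2)[of x] CondFalse.prems(1) CondFalse.hyps by simp
  with 1 show ?case using exec.CondFalse by blast
next
  case (WhileFalse s x c)
  then have "r x = Leaf" using WhileFalse.prems(2)[of x] by simp
  with WhileFalse exec.WhileFalse[of r x c] show ?case by (intro exI[of _ r]) auto
next
  case (WhileTrue s x c t s' u s'')
  from WhileTrue.prems WhileTrue.IH(1)[of r] obtain r1 where 1: "exec c r t r1" "\<forall>v<N. s' v = r1 v" "\<forall>v\<ge>N. r1 v = r v"
    by auto
  from WhileTrue.prems WhileTrue.IH(2)[of r1] 1 obtain r2 where
    2: "exec (While x c) r1 u r2" "\<forall>v<N. s'' v = r2 v" "\<forall>v\<ge>N. r2 v = r1 v" by auto
  have "r x \<noteq> Leaf" using WhileTrue.prems(2)[of x] WhileTrue.prems(1) WhileTrue.hyps by simp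
  with 1 2 show ?case using exec.WhileTrue[of r x c t r1 u r2] by (intro exI[of _ r2]) auto
qed

text \<open>Sharing lets the size of a tree double in one step (\<open>Node x x\<close>), but its
  height grows by at most one. Height is therefore the size measure that running times
  control.\<close>

primrec height :: "dtree \<Rightarrow> nat" where
  "height Leaf = 0"
| "height (Node a b) = Suc (max (height a) (height b))"

lemma height_left: "height (left a) \<le> height a" by (cases a) auto
lemma height_right: "height (right a) \<le> height a" by (cases a) auto

lemma exec_height:
  "exec c s t s' \<Longrightarrow> (\<And>v. height (s v) \<le> H) \<Longrightarrow> height (s' v) \<le> H + t"
proof (induction arbitrary: H v rule: exec.induct)
  case (Copy x y s) then show ?case by (simp add: le_Suc_eq)
next
  case (SetLeft x y s) then show ?case
    using height_left[of "s y"] by (auto simp: le_Suc_eq intro: le_trans)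
next
  case (SetRight x y s) then show ?case
    using height_right[of "s y"] by (auto simp: le_Suc_eq intro: le_trans)
next
  case (SetNode x y z s)
  have "max (height (s y)) (height (s z)) \<le> H" using SetNode.prems by simp
  then show ?case using SetNode.prems[of v] by simp
next
  case (Seq c s t s' d u s'')
  show ?case using Seq.IH(2)[of "H+t" v] Seq.IH(1)[OF Seq.prems] by (simp add: add.assoc)
next
  case (CondTrue s x c t s' d) show ?case using CondTrue.IH[OF CondTrue.prems, of v] by simp
next
  case (CondFalse s x d t s' c) show ?case using CondFalse.IH[OF CondFalse.prems, of v] by simp
next
  case (WhileTrue s x c t s' u s'')
  show ?case using WhileTrue.IH(2)[of "H+t" v] WhileTrue.IH(1)[OF WhileTrue.prems] by simp
next
  case (SetLeaf x s) then show ?case by (simp add: le_Suc_eq)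
next
  case (Skip s) then show ?case by (simp add: le_Suc_eq)
next
  case (WhileFalse s x c) then show ?case by (simp add: le_Suc_eq)
qed

text \<open>Programs are composed with all data passed through variable 0; the bound \<open>N\<close> tells which
  variables are free for the surrounding program, and a program may not rely on the initial contents
  of its work variables.\<close>

definition maps :: "prog \<Rightarrow> nat \<Rightarrow> dtree \<Rightarrow> nat \<Rightarrow> dtree \<Rightarrow> bool" where
  "maps P N x T y \<longleftrightarrow> (\<forall>s. s 0 = x \<longrightarrow>
     (\<exists>t s'. exec P s t s' \<and> t \<le> T \<and> s' 0 = y \<and> (\<forall>v. v > 0 \<and> v \<ge> N \<longrightarrow> s' v = s v)))"

lemma mapsE:
  assumes "maps P N x T y" "s 0 = x"
  obtains t s' where "exec P s t s'" "t \<le> T" "s' 0 = y" "\<forall>v. v > 0 \<and> v \<ge> N \<longrightarrow> s' v = s v"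
  using assms unfolding maps_def by blast

lemma maps_height:
  assumes "maps P N x T y" shows "height y \<le> height x + T"
proof -
  let ?s = "(\<lambda>_. Leaf)(0 := x)"
  obtain t s' where 1: "exec P ?s t s'" "t \<le> T" "s' 0 = y"
    using assms unfolding maps_def by (metis fun_upd_same)
  have "height (s' 0) \<le> height x + t" by (rule exec_height[OF 1(1)]) auto
  with 1 show ?thesis by simp
qed

lemma maps_runs:
  assumes "maps P N x T y" shows "\<exists>t\<le>T. runs P x t y"
  using assms unfolding maps_def runs_def by (metis fun_upd_same)

text \<open>\<open>runs\<close> speaks only about stores whose work variables are all
  \<open>Leaf\<close>. Clearing the variables from 1 to \<open>n - 1\<close> restores this in the
  middle of a larger program, while variable 0 keeps the data.\<close>

primrec clear :: "nat \<Rightarrow> prog" where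
  "clear 0 = Skip"
| "clear (Suc n) = Seq (clear n) (if n = 0 then Skip else SetLeaf n)"

lemma exec_clear:
  "exec (clear n) s (Suc n) (\<lambda>v. if 0 < v \<and> v < n then Leaf else s v)"
proof (induction n)
  case 0 then show ?case using exec.Skip by simp
next
  case (Suc n)
  let ?r = "\<lambda>v. if 0 < v \<and> v < n then Leaf else s v"
  show ?case
  proof (cases "n = 0")
    case True
    have e: "(\<lambda>v. if 0 < v \<and> v < Suc n then Leaf else s v) = ?r" using True by (auto simp: fun_eq_iff)
    show ?thesis using exec.Seq[OF Suc.IH exec.Skip] True unfolding e by simp
  next
    case False
    have e: "(\<lambda>v. if 0 < v \<and> v < Suc n then Leaf else s v) = ?r(n := Leaf)"
      using False by (auto simp: fun_eq_iff)
    show ?thesis using exec.Seq[OF Suc.IH exec.SetLeaf[of n]] False unfolding e by simp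
  qed
qed

lemma runs_maps:
  assumes "runs P x t y" "vbound P \<le> N" "0 < N"
  shows "maps (Seq (clear N) P) N x (t + N + 1) y"
  unfolding maps_def
proof (intro allI impI)
  fix s :: store assume s: "s 0 = x"
  let ?s = "\<lambda>v. if 0 < v \<and> v < N then Leaf else s v"
  from assms obtain s1 where 1: "exec P ((\<lambda>_. Leaf)(0 := x)) t s1" "s1 0 = y" unfolding runs_def by blast
  have "((\<lambda>_. Leaf)(0 := x)) v = ?s v" if "v < N" for v using that s by auto
  then obtain r where r: "exec P ?s t r" "\<forall>v<N. s1 v = r v" "\<forall>v\<ge>N. r v = ?s v"
    using exec_frame[OF 1(1) assms(2), of ?s] by blast
  show "\<exists>t' s'. exec (Seq (clear N) P) s t' s' \<and> t' \<le> t + N + 1 \<and> s' 0 = y \<and> (\<forall>v. v > 0 \<and> v \<ge> N \<longrightarrow> s' v = s v)"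
    using exec.Seq[OF exec_clear r(1)] r 1 assms(3)
    by (intro exI[of _ "Suc N + t"] exI[of _ r]) auto
qed

lemma maps_seq:
  assumes "maps P N x T y" "maps Q N' y U z"
  shows "maps (Seq P Q) (max N N') x (T + U) z"
  unfolding maps_def
proof (intro allI impI)
  fix s :: store assume s: "s 0 = x"
  obtain t s1 where 1: "exec P s t s1" "t \<le> T" "s1 0 = y" "\<forall>v. v > 0 \<and> v \<ge> N \<longrightarrow> s1 v = s v"
    using assms(1) s unfolding maps_def by blast
  obtain u s2 where 2: "exec Q s1 u s2" "u \<le> U" "s2 0 = z" "\<forall>v. v > 0 \<and> v \<ge> N' \<longrightarrow> s2 v = s1 v"
    using assms(2) 1 unfolding maps_def by blast
  show "\<exists>t s'. exec (Seq P Q) s t s' \<and> t \<le> T + U \<and> s' 0 = z \<and> (\<forall>v. v > 0 \<and> v \<ge> max N N' \<longrightarrow> s' v = s v)"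
    using exec.Seq[OF 1(1) 2(1)] 1 2 by (intro exI[of _ "t+u"] exI[of _ s2]) auto
qed

text \<open>The variables \<open>z\<close> and \<open>z + 1\<close> lie beyond the work variables of
  both programs: \<open>z\<close> saves the input for \<open>Q\<close>, and \<open>z + 1\<close>
  saves the result of \<open>P\<close>. Conditionals use the same two slots for the input and the
  test value.\<close>

definition pair_prog :: "prog \<Rightarrow> prog \<Rightarrow> nat \<Rightarrow> prog" where
  "pair_prog P Q z = Seq (Copy z 0) (Seq P (Seq (Copy (Suc z) 0) (Seq (Copy 0 z) (Seq Q (SetNode 0 (Suc z) 0)))))"

lemma maps_pair:
  assumes "maps P N x T y" "maps Q N' x U y'" "N \<le> z" "N' \<le> z" "0 < z"
  shows "maps (pair_prog P Q z) (z + 2) x (T + U + 4) (Node y y')"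
  unfolding maps_def
proof (intro allI impI)
  fix s :: store assume s: "s 0 = x"
  let ?s0 = "s(z := s 0)"
  have "?s0 0 = x" using s assms(5) by simp
  then obtain t s1 where 1: "exec P ?s0 t s1" "t \<le> T" "s1 0 = y" "\<forall>v. v > 0 \<and> v \<ge> N \<longrightarrow> s1 v = ?s0 v"
    using assms(1) unfolding maps_def by blast
  let ?s2 = "(s1(Suc z := s1 0))"
  let ?s3 = "?s2(0 := ?s2 z)"
  have "?s3 0 = x" using 1 s assms by simp
  then obtain u s4 where 2: "exec Q ?s3 u s4" "u \<le> U" "s4 0 = y'" "\<forall>v. v > 0 \<and> v \<ge> N' \<longrightarrow> s4 v = ?s3 v"
    using assms(2) unfolding maps_def by blast
  let ?s5 = "s4(0 := Node (s4 (Suc z)) (s4 0))"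
  have "exec (pair_prog P Q z) s (1 + (t + (1 + (1 + (u + 1))))) ?s5"
    unfolding pair_prog_def
    by (rule exec.Seq[OF exec.Copy exec.Seq[OF 1(1) exec.Seq[OF exec.Copy exec.Seq[OF exec.Copy exec.Seq[OF 2(1) exec.SetNode]]]]])
  moreover have "?s5 0 = Node y y'" using 1 2 assms by simp
  moreover have "\<forall>v. v > 0 \<and> v \<ge> z + 2 \<longrightarrow> ?s5 v = s v" using 1 2 assms by auto
  ultimately show "\<exists>t s'. exec (pair_prog P Q z) s t s' \<and> t \<le> T + U + 4 \<and> s' 0 = Node y y' \<and> (\<forall>v. v > 0 \<and> v \<ge> z + 2 \<longrightarrow> s' v = s v)"
    using 1(2) 2(2) by (intro exI[of _ "1 + (t + (1 + (1 + (u + 1))))"] exI[of _ ?s5]) simp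
qed

definition if_prog :: "prog \<Rightarrow> prog \<Rightarrow> prog \<Rightarrow> nat \<Rightarrow> prog" where
  "if_prog B P Q z = Seq (Copy z 0) (Seq B (Seq (Copy (Suc z) 0) (Seq (Copy 0 z) (Cond (Suc z) P Q))))"

lemma maps_if:
  assumes B: "maps B N x T b" "N \<le> z" and z: "0 < z"
    and P: "b \<noteq> Leaf \<Longrightarrow> maps P N' x U y" "N' \<le> z"
    and Q: "b = Leaf \<Longrightarrow> maps Q N'' x U y" "N'' \<le> z"
  shows "maps (if_prog B P Q z) (z + 2) x (T + U + 4) y"
  unfolding maps_def
proof (intro allI impI)
  fix s :: store assume s: "s 0 = x"
  let ?s0 = "s(z := s 0)"
  have "?s0 0 = x" using s z by simp
  then obtain t s1 where 1: "exec B ?s0 t s1" "t \<le> T" "s1 0 = b" "\<forall>v. v > 0 \<and> v \<ge> N \<longrightarrow> s1 v = ?s0 v"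
    using B unfolding maps_def by blast
  let ?s2 = "(s1(Suc z := s1 0))"
  let ?s3 = "?s2(0 := ?s2 z)"
  have s3: "?s3 0 = x" using 1 s assms by simp
  have "\<exists>u s4. exec (Cond (Suc z) P Q) ?s3 (1 + u) s4 \<and> u \<le> U \<and> s4 0 = y \<and> (\<forall>v. v > 0 \<and> v \<ge> z \<longrightarrow> s4 v = ?s3 v)"
  proof (cases "b = Leaf")
    case True
    then obtain u s4 where 4: "exec Q ?s3 u s4" "u \<le> U" "s4 0 = y" "\<forall>v. v > 0 \<and> v \<ge> N'' \<longrightarrow> s4 v = ?s3 v"
      using Q s3 unfolding maps_def by blast
    have "?s3 (Suc z) = Leaf" using True 1 by simp
    from exec.CondFalse[where x = "Suc z" and c = P, OF this 4(1)] show ?thesis using 4 Q(2)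
      by (intro exI[of _ u] exI[of _ s4]) simp
  next
    case False
    then obtain u s4 where 4: "exec P ?s3 u s4" "u \<le> U" "s4 0 = y" "\<forall>v. v > 0 \<and> v \<ge> N' \<longrightarrow> s4 v = ?s3 v"
      using P s3 unfolding maps_def by blast
    have "?s3 (Suc z) \<noteq> Leaf" using False 1 by simp
    from exec.CondTrue[where x = "Suc z" and d = Q, OF this 4(1)] show ?thesis using 4 P(2)
      by (intro exI[of _ u] exI[of _ s4]) simp
  qed
  then obtain u s4 where 2: "exec (Cond (Suc z) P Q) ?s3 (1 + u) s4" "u \<le> U" "s4 0 = y" "\<forall>v. v > 0 \<and> v \<ge> z \<longrightarrow> s4 v = ?s3 v"
    by blast
  have "exec (if_prog B P Q z) s (1 + (t + (1 + (1 + (1 + u))))) s4"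
    unfolding if_prog_def
    by (rule exec.Seq[OF exec.Copy exec.Seq[OF 1(1) exec.Seq[OF exec.Copy exec.Seq[OF exec.Copy 2(1)]]]])
  moreover have "\<forall>v. v > 0 \<and> v \<ge> z + 2 \<longrightarrow> s4 v = s v" using 1 2 assms by auto
  ultimately show "\<exists>t s'. exec (if_prog B P Q z) s t s' \<and> t \<le> T + U + 4 \<and> s' 0 = y \<and> (\<forall>v. v > 0 \<and> v \<ge> z + 2 \<longrightarrow> s' v = s v)"
    using 1(2) 2(2,3) by (intro exI[of _ "1 + (t + (1 + (1 + (1 + u))))"] exI[of _ s4]) simp
qed

text \<open>The loop keeps the environment \<open>x\<close> in variable \<open>z\<close>, the rest of the list in \<open>z + 1\<close>
  and the accumulator in \<open>z + 2\<close>.\<close>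

definition fold_body :: "prog \<Rightarrow> nat \<Rightarrow> prog" where
  "fold_body P z = Seq (SetLeft (z+3) (z+1)) (Seq (SetRight (z+1) (z+1))
     (Seq (SetNode 0 (z+2) (z+3)) (Seq (SetNode 0 z 0) (Seq P (Copy (z+2) 0)))))"

text \<open>The accumulators form an arbitrary sequence \<open>a\<close>, so the body has to be
  correct only on values that really occur. At this point \<open>j\<close> entries are consumed and
  \<open>n\<close> remain; a round costs one test and five assignments besides the body.\<close>

lemma fold_loop:
  assumes P: "\<And>i. i < length l \<Longrightarrow> maps P N (Node x (Node (a i) (l ! i))) T (a (Suc i))"
    and z: "N \<le> z" "0 < z"
  shows "s z = x \<Longrightarrow> s (z+1) = enc_list (drop j l) \<Longrightarrow> s (z+2) = a j \<Longrightarrow> j + n = length l \<Longrightarrow>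
    \<exists>t s'. exec (While (z+1) (fold_body P z)) s t s' \<and> t \<le> 1 + n * (T + 6) \<and> s' (z+2) = a (length l)
       \<and> (\<forall>v. v > z + 3 \<longrightarrow> s' v = s v)"
proof (induction n arbitrary: s j)
  case 0
  then have "s (z+1) = Leaf" by simp
  then show ?case using 0 exec.WhileFalse by (intro exI[of _ 1] exI[of _ s]) auto
next
  case (Suc n)
  then have j: "j < length l" by simp
  then have d: "drop j l = l ! j # drop (Suc j) l" by (simp add: Cons_nth_drop_Suc)
  then have c: "s (z+1) = Node (l ! j) (enc_list (drop (Suc j) l))" using Suc.prems(2) by simp
  let ?s1 = "s(z+3 := left (s (z+1)))"
  let ?s2 = "?s1(z+1 := right (?s1 (z+1)))"
  let ?s3 = "?s2(0 := Node (?s2 (z+2)) (?s2 (z+3)))"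
  let ?s4 = "?s3(0 := Node (?s3 z) (?s3 0))"
  have "?s4 0 = Node x (Node (a j) (l ! j))" using z by (simp add: c[simplified] Suc.prems(1,3)[simplified])
  from mapsE[where s = ?s4, OF P[OF j] this]
  obtain t s5 where 5: "exec P ?s4 t s5" "t \<le> T" "s5 0 = a (Suc j)" "\<forall>v. v > 0 \<and> v \<ge> N \<longrightarrow> s5 v = ?s4 v" .
  let ?s6 = "s5(z+2 := s5 0)"
  have e: "exec (fold_body P z) s (1 + (1 + (1 + (1 + (t + 1))))) ?s6"
    unfolding fold_body_def
    by (rule exec.Seq[OF exec.SetLeft exec.Seq[OF exec.SetRight exec.Seq[OF exec.SetNode exec.Seq[OF exec.SetNode exec.Seq[OF 5(1) exec.Copy]]]]])
  have 6: "?s6 z = x" "?s6 (z+1) = enc_list (drop (Suc j) l)" "?s6 (z+2) = a (Suc j)" "Suc j + n = length l"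
    "\<forall>v. v > z + 3 \<longrightarrow> ?s6 v = s v"
    using 5 z Suc.prems(1,4) by (auto simp: c[simplified])
  obtain u s7 where 7: "exec (While (z+1) (fold_body P z)) ?s6 u s7" "u \<le> 1 + n * (T + 6)" "s7 (z+2) = a (length l)"
       "\<forall>v. v > z + 3 \<longrightarrow> s7 v = ?s6 v"
    using Suc.IH[OF 6(1-4)] by blast
  have "exec (While (z+1) (fold_body P z)) s (1 + (1 + (1 + (1 + (1 + (t + 1))))) + u) s7"
    by (rule exec.WhileTrue[OF _ e 7(1)]) (simp add: c[simplified])
  moreover have "1 + (1 + (1 + (1 + (1 + (t + 1))))) + u \<le> 1 + Suc n * (T + 6)"
    using 5(2) 7(2) by simp
  ultimately show ?case using 7(3,4) 6(5)
    by (intro exI[of _ "1 + (1 + (1 + (1 + (1 + (t + 1))))) + u"] exI[of _ s7]) simp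
qed

definition fold_prog :: "prog \<Rightarrow> prog \<Rightarrow> prog \<Rightarrow> nat \<Rightarrow> prog" where
  "fold_prog I Q P z = Seq (Copy z 0) (Seq I (Seq (Copy (z+2) 0) (Seq (Copy 0 z) (Seq Q
     (Seq (Copy (z+1) 0) (Seq (While (z+1) (fold_body P z)) (Copy 0 (z+2))))))))"

lemma maps_fold:
  assumes I: "maps I N x T (a 0)" "N \<le> z" and Q: "maps Q N' x U (enc_list l)" "N' \<le> z"
    and P: "\<And>i. i < length l \<Longrightarrow> maps P N'' (Node x (Node (a i) (l ! i))) V (a (Suc i))" "N'' \<le> z"
    and z: "0 < z"
  shows "maps (fold_prog I Q P z) (z + 4) x (T + U + length l * (V + 6) + 6) (a (length l))"
  unfolding maps_def
proof (intro allI impI)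
  fix s :: store assume s: "s 0 = x"
  let ?s0 = "s(z := s 0)"
  have "?s0 0 = x" using s z by simp
  then obtain t s1 where 1: "exec I ?s0 t s1" "t \<le> T" "s1 0 = a 0" "\<forall>v. v > 0 \<and> v \<ge> N \<longrightarrow> s1 v = ?s0 v"
    using I unfolding maps_def by blast
  let ?s2 = "(s1(z+2 := s1 0))"
  let ?s3 = "?s2(0 := ?s2 z)"
  have s3: "?s3 0 = x" using 1 s assms by simp
  then obtain u s4 where 2: "exec Q ?s3 u s4" "u \<le> U" "s4 0 = enc_list l" "\<forall>v. v > 0 \<and> v \<ge> N' \<longrightarrow> s4 v = ?s3 v"
    using Q unfolding maps_def by blast
  let ?s5 = "s4(z+1 := s4 0)"
  have 5: "?s5 z = x" "?s5 (z+1) = enc_list (drop 0 l)" "?s5 (z+2) = a 0" "0 + length l = length l"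
    using 1 2 assms s by auto
  obtain w s6 where 6: "exec (While (z+1) (fold_body P z)) ?s5 w s6" "w \<le> 1 + length l * (V + 6)" "s6 (z+2) = a (length l)"
       "\<forall>v. v > z + 3 \<longrightarrow> s6 v = ?s5 v"
    using fold_loop[OF P(1) P(2) z 5] by blast
  let ?s7 = "s6(0 := s6 (z+2))"
  let ?t = "1 + (t + (1 + (1 + (u + (1 + (w + 1))))))"
  have "exec (fold_prog I Q P z) s ?t ?s7"
    unfolding fold_prog_def
    by (rule exec.Seq[OF exec.Copy exec.Seq[OF 1(1) exec.Seq[OF exec.Copy exec.Seq[OF exec.Copy exec.Seq[OF 2(1)
          exec.Seq[OF exec.Copy exec.Seq[OF 6(1) exec.Copy]]]]]]])
  moreover have "?t \<le> T + U + length l * (V + 6) + 6" using 1(2) 2(2) 6(2) by simp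
  moreover have "?s7 0 = a (length l)" using 6 by simp
  moreover have "\<forall>v. v > 0 \<and> v \<ge> z + 4 \<longrightarrow> ?s7 v = s v" using 1 2 6 assms by auto
  ultimately show "\<exists>t s'. exec (fold_prog I Q P z) s t s' \<and> t \<le> T + U + length l * (V + 6) + 6 \<and> s' 0 = a (length l)
     \<and> (\<forall>v. v > 0 \<and> v \<ge> z + 4 \<longrightarrow> s' v = s v)" by (intro exI[of _ ?t] exI[of _ ?s7]) simp
qed


section \<open>Polynomial-time functions on encoded data\<close>

class enc = fixes enc :: "'a \<Rightarrow> dtree"

text \<open>The output of an unknown program need not encode anything, so raw trees have to be data
  as well.\<close>

instantiation dtree :: enc begin
definition "enc (x :: dtree) = x"
instance ..
end

instantiation unit :: enc begin
definition "enc (x :: unit) = Leaf"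
instance ..
end

instantiation nat :: enc begin
definition "enc (x :: nat) = enc_nat x"
instance ..
end

instantiation bool :: enc begin
definition "enc (x :: bool) = enc_bool x"
instance ..
end

instantiation list :: (enc) enc begin
definition "enc (x :: 'a list) = enc_list (map enc x)"
instance ..
end

instantiation prod :: (enc, enc) enc begin
definition "enc (x :: 'a \<times> 'b) = Node (enc (fst x)) (enc (snd x))"
instance ..
end

abbreviation hgt :: "'a::enc \<Rightarrow> nat" where "hgt x \<equiv> height (enc x)"

lemma enc_simps [simp]:
  "enc [] = Leaf" "enc (y # ys) = Node (enc y) (enc ys)" "enc (a, b) = Node (enc a) (enc b)"
  "enc (0::nat) = Leaf" "enc (Suc n) = Node Leaf (enc n)" "enc False = Leaf" "enc True = Node Leaf Leaf"
  "enc () = Leaf"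
  by (simp_all add: enc_list_def enc_prod_def enc_nat_def Defs.enc_nat_def enc_bool_def Defs.enc_bool_def enc_unit_def)

lemma hgt_nat [simp]: "hgt (n::nat) = n"
  by (induction n) auto

lemma hgt_bool: "hgt (b::bool) \<le> 1" by (cases b) auto

lemma length_le_hgt: "length xs \<le> hgt xs"
  by (induction xs) auto

lemma elem_le_hgt: "x \<in> set xs \<Longrightarrow> hgt x \<le> hgt xs"
  by (induction xs) auto

lemma hgt_le: "(\<And>x. x \<in> set xs \<Longrightarrow> hgt x \<le> M) \<Longrightarrow> hgt xs \<le> length xs + M"
proof (induction xs)
  case (Cons x xs)
  then have "hgt x \<le> M" "hgt xs \<le> length xs + M" by auto
  then show ?case by simp
qed simp

lemma hgt_pair_le: "hgt (a, b) \<le> Suc (hgt a + hgt b)" by simp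


section \<open>Programs computing functions on encoded data\<close>

definition computes :: "'a::enc set \<Rightarrow> ('a \<Rightarrow> 'b::enc) \<Rightarrow> ('a \<Rightarrow> nat) \<Rightarrow> bool" where
  "computes D f T \<longleftrightarrow> (\<exists>P N. \<forall>x\<in>D. maps P N (enc x) (T x) (enc (f x)))"

lemma maps_mono:
  assumes "maps P N x T y" "T \<le> T'" "N \<le> N'" shows "maps P N' x T' y"
  unfolding maps_def
proof (intro allI impI)
  fix s :: store assume "s 0 = x"
  from mapsE[of P N x T y s, OF assms(1) this]
  obtain t s' where "exec P s t s'" "t \<le> T" "s' 0 = y" "\<forall>v. v > 0 \<and> v \<ge> N \<longrightarrow> s' v = s v" .
  then show "\<exists>t s'. exec P s t s' \<and> t \<le> T' \<and> s' 0 = y \<and> (\<forall>v. v > 0 \<and> v \<ge> N' \<longrightarrow> s' v = s v)"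
    using assms by (intro exI[of _ t] exI[of _ s']) auto
qed

lemma computes_mono: "computes D f T \<Longrightarrow> D' \<subseteq> D \<Longrightarrow> (\<And>x. x \<in> D' \<Longrightarrow> T x \<le> T' x) \<Longrightarrow> computes D' f T'"
  unfolding computes_def by (meson maps_mono order_refl subsetD)

lemma computes_height: "computes D f T \<Longrightarrow> x \<in> D \<Longrightarrow> hgt (f x) \<le> hgt x + T x"
  unfolding computes_def using maps_height by blast

lemma computes_recode: "(\<And>x. x \<in> D \<Longrightarrow> enc (f x) = enc x) \<Longrightarrow> computes D f (\<lambda>_. 1)"
  unfolding computes_def maps_def
  by (intro exI[of _ Skip] exI[of _ 0]) (metis exec.Skip order_refl)

lemma computes_compose:
  assumes "computes D f T" "computes E g U" "\<And>x. x \<in> D \<Longrightarrow> f x \<in> E"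
  shows "computes D (\<lambda>x. g (f x)) (\<lambda>x. T x + U (f x))"
  using assms unfolding computes_def by (meson maps_seq)

lemma computes_Pair:
  assumes "computes D f T" "computes D g U"
  shows "computes D (\<lambda>x. (f x, g x)) (\<lambda>x. T x + U x + 4)"
proof -
  obtain P N Q M where "\<forall>x\<in>D. maps P N (enc x) (T x) (enc (f x))" "\<forall>x\<in>D. maps Q M (enc x) (U x) (enc (g x))"
    using assms unfolding computes_def by blast
  then have "\<forall>x\<in>D. maps (pair_prog P Q (N+M+1)) (N+M+1 + 2) (enc x) (T x + U x + 4) (enc (f x, g x))"
    unfolding enc_simps by (intro ballI maps_pair) auto
  then show ?thesis unfolding computes_def by blast
qed

lemma computes_Cons:
  assumes "computes D f T" "computes D g U"
  shows "computes D (\<lambda>x. f x # g x) (\<lambda>x. T x + U x + 4)"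
  using computes_Pair[OF assms] by (simp add: computes_def)

lemma maps_SetLeft: "maps (SetLeft 0 0) 0 x 1 (left x)"
  unfolding maps_def
proof (intro allI impI)
  fix s :: store assume "s 0 = x"
  then show "\<exists>t s'. exec (SetLeft 0 0) s t s' \<and> t \<le> 1 \<and> s' 0 = left x \<and> (\<forall>v. v > 0 \<and> v \<ge> 0 \<longrightarrow> s' v = s v)"
    by (intro exI[of _ 1] exI[of _ "s(0 := left (s 0))"] conjI exec.SetLeft) auto
qed

lemma computes_left: "(\<And>x. x \<in> D \<Longrightarrow> enc (f x) = left (enc x)) \<Longrightarrow> computes D f (\<lambda>_. 1)"
  unfolding computes_def
proof (intro exI[of _ "SetLeft 0 0"] exI[of _ 0] ballI)
  fix x assume "x \<in> D" "\<And>x. x \<in> D \<Longrightarrow> enc (f x) = left (enc x)"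
  then show "maps (SetLeft 0 0) 0 (enc x) 1 (enc (f x))" using maps_SetLeft by metis
qed

lemma maps_SetRight: "maps (SetRight 0 0) 0 x 1 (right x)"
  unfolding maps_def
proof (intro allI impI)
  fix s :: store assume "s 0 = x"
  then show "\<exists>t s'. exec (SetRight 0 0) s t s' \<and> t \<le> 1 \<and> s' 0 = right x \<and> (\<forall>v. v > 0 \<and> v \<ge> 0 \<longrightarrow> s' v = s v)"
    by (intro exI[of _ 1] exI[of _ "s(0 := right (s 0))"] conjI exec.SetRight) auto
qed

lemma computes_right: "(\<And>x. x \<in> D \<Longrightarrow> enc (f x) = right (enc x)) \<Longrightarrow> computes D f (\<lambda>_. 1)"
  unfolding computes_def
proof (intro exI[of _ "SetRight 0 0"] exI[of _ 0] ballI)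
  fix x assume "x \<in> D" "\<And>x. x \<in> D \<Longrightarrow> enc (f x) = right (enc x)"
  then show "maps (SetRight 0 0) 0 (enc x) 1 (enc (f x))" using maps_SetRight by metis
qed

lemma maps_const: "\<exists>P N T. \<forall>x. maps P N x T y"
proof (induction y)
  case Leaf
  have "\<forall>x. maps (SetLeaf 0) 0 x 1 Leaf"
    unfolding maps_def
  proof (intro allI impI)
    fix x :: dtree and s :: store
    show "\<exists>t s'. exec (SetLeaf 0) s t s' \<and> t \<le> 1 \<and> s' 0 = Leaf \<and> (\<forall>v. v > 0 \<and> v \<ge> 0 \<longrightarrow> s' v = s v)"
      by (intro exI[of _ 1] exI[of _ "s(0 := Leaf)"] conjI exec.SetLeaf) auto
  qed
  then show ?case by blast
next
  case (Node y z)
  then obtain P N T Q M U where "\<forall>x. maps P N x T y" "\<forall>x. maps Q M x U z" by blast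
  then have "\<forall>x. maps (pair_prog P Q (N+M+1)) (N+M+1+2) x (T + U + 4) (Node y z)"
    by (intro allI maps_pair) auto
  then show ?case by blast
qed

lemma computes_const: "\<exists>T. computes D (\<lambda>_. y) (\<lambda>_. T)"
  using maps_const[of "enc y"] unfolding computes_def by meson

text \<open>The test is a raw tree, which serves Boolean conditions and the nonemptiness of lists
  alike.\<close>

lemma computes_if':
  assumes B: "\<exists>P N. \<forall>x\<in>D. maps P N (enc x) (T x) (b x)" and "computes D f U" "computes D g V"
  shows "computes D (\<lambda>x. if b x \<noteq> Leaf then f x else g x) (\<lambda>x. T x + (U x + V x) + 4)"
proof -
  obtain B L where "\<forall>x\<in>D. maps B L (enc x) (T x) (b x)" using B by blast
  moreover obtain P N Q M where "\<forall>x\<in>D. maps P N (enc x) (U x) (enc (f x))" "\<forall>x\<in>D. maps Q M (enc x) (V x) (enc (g x))"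
    using assms unfolding computes_def by blast
  ultimately have "\<forall>x\<in>D. maps (if_prog B P Q (N+M+L+1)) (N+M+L+1 + 2) (enc x) (T x + (U x + V x) + 4) (enc (if b x \<noteq> Leaf then f x else g x))"
    by (intro ballI maps_if[where N = L and N' = N and N'' = M and b = "b x" for x])
       (auto intro: maps_mono[OF _ _ order_refl] simp: Bex_def)
  then show ?thesis unfolding computes_def by blast
qed

lemma computes_If:
  assumes "computes D b T" "computes D f U" "computes D g V"
  shows "computes D (\<lambda>x. if b x then f x else g x) (\<lambda>x. T x + (U x + V x) + 4)"
proof -
  have *: "(enc c \<noteq> Leaf) = c" for c :: bool by (cases c) auto
  show ?thesis using computes_if'[of D T "\<lambda>x. enc (b x)" f U g V] assms by (simp add: computes_def[of D b] *)
qed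

text \<open>A polynomial-time body may still double its accumulator in every round. The bound
  \<open>B\<close> on all intermediate accumulators excludes this and gives every round the same
  cost bound.\<close>

lemma computes_foldl:
  assumes init: "computes D init T" and lst: "computes D lst U"
    and body: "computes UNIV (\<lambda>p. f (fst p) (fst (snd p)) (snd (snd p))) (\<lambda>p. (hgt p + 2) ^ c)"
    and B: "\<And>x ys zs. x \<in> D \<Longrightarrow> lst x = ys @ zs \<Longrightarrow> hgt (foldl (f x) (init x) ys) \<le> B x"
  shows "computes D (\<lambda>x. foldl (f x) (init x) (lst x))
    (\<lambda>x. T x + U x + length (lst x) * ((hgt x + B x + hgt (lst x) + 4) ^ c + 6) + 6)"
proof -
  obtain I N where I: "\<forall>x\<in>D. maps I N (enc x) (T x) (enc (init x))"
    using init unfolding computes_def by blast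
  obtain Q M where Q: "\<forall>x\<in>D. maps Q M (enc x) (U x) (enc (lst x))"
    using lst unfolding computes_def by blast
  obtain P L where P: "\<And>x a e. maps P L (enc (x, a, e)) ((hgt (x, a, e) + 2) ^ c) (enc (f x a e))"
    using body unfolding computes_def by fastforce
  have "maps (fold_prog I Q P (N+M+L+1)) (N+M+L+1+4) (enc x)
      (T x + U x + length (lst x) * ((hgt x + B x + hgt (lst x) + 4) ^ c + 6) + 6)
      (enc (foldl (f x) (init x) (lst x)))" if x: "x \<in> D" for x
  proof -
    let ?a = "\<lambda>i. enc (foldl (f x) (init x) (take i (lst x)))"
    have "maps (fold_prog I Q P (N+M+L+1)) (N+M+L+1+4) (enc x)
      (T x + U x + length (map enc (lst x)) * ((hgt x + B x + hgt (lst x) + 4) ^ c + 6) + 6) (?a (length (map enc (lst x))))"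
    proof (rule maps_fold[where N = N and N' = M and N'' = L])
      show "maps I N (enc x) (T x) (?a 0)" using I x by simp
      show "maps Q M (enc x) (U x) (enc_list (map enc (lst x)))" using Q x by (simp add: enc_list_def)
      fix i assume i: "i < length (map enc (lst x))"
      let ?s = "foldl (f x) (init x) (take i (lst x))"
      have "hgt ?s \<le> B x" by (rule B[OF x, of _ "drop i (lst x)"]) simp
      moreover have "hgt (lst x ! i) \<le> hgt (lst x)" using i by (intro elem_le_hgt) simp
      ultimately have "hgt (x, ?s, lst x ! i) + 2 \<le> hgt x + B x + hgt (lst x) + 4" by simp
      from maps_mono[OF P power_mono[OF this] order_refl]
      have "maps P L (enc (x, ?s, lst x ! i)) ((hgt x + B x + hgt (lst x) + 4) ^ c) (enc (f x ?s (lst x ! i)))" by simp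
      then show "maps P L (Node (enc x) (Node (?a i) (map enc (lst x) ! i))) ((hgt x + B x + hgt (lst x) + 4) ^ c) (?a (Suc i))"
        using i by (simp add: take_Suc_conv_app_nth)
    qed auto
    then show ?thesis by simp
  qed
  then show ?thesis unfolding computes_def by blast
qed


section \<open>Polynomial bounds and polynomial-time functions\<close>

definition poly_bounded :: "'a set \<Rightarrow> ('a \<Rightarrow> nat) \<Rightarrow> ('a \<Rightarrow> nat) \<Rightarrow> bool" where
  "poly_bounded X S b \<longleftrightarrow> (\<forall>x\<in>X. 2 \<le> S x) \<and> (\<exists>c. \<forall>x\<in>X. b x \<le> S x ^ c)"

lemma poly_bounded_mono: "poly_bounded X S b \<Longrightarrow> (\<And>x. x \<in> X \<Longrightarrow> a x \<le> b x) \<Longrightarrow> poly_bounded X S a"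
  unfolding poly_bounded_def by (meson order_trans)

lemma poly_bounded_self: "(\<And>x. x \<in> X \<Longrightarrow> 2 \<le> S x) \<Longrightarrow> poly_bounded X S S"
  unfolding poly_bounded_def by (metis order_refl power_one_right)

lemma poly_bounded_const: "(\<And>x. x \<in> X \<Longrightarrow> 2 \<le> S x) \<Longrightarrow> poly_bounded X S (\<lambda>_. n)"
proof -
  have "n \<le> h ^ n" if "2 \<le> h" for h :: nat
    using order_trans[OF less_imp_le[OF less_exp] power_mono[OF that]] by simp
  then show "(\<And>x. x \<in> X \<Longrightarrow> 2 \<le> S x) \<Longrightarrow> poly_bounded X S (\<lambda>_. n)" unfolding poly_bounded_def by blast
qed

lemma poly_bounded_mult:
  assumes "poly_bounded X S a" "poly_bounded X S b" shows "poly_bounded X S (\<lambda>x. a x * b x)"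
proof -
  obtain c d where "\<forall>x\<in>X. a x \<le> S x ^ c" "\<forall>x\<in>X. b x \<le> S x ^ d"
    using assms unfolding poly_bounded_def by blast
  then have "\<forall>x\<in>X. a x * b x \<le> S x ^ (c + d)" unfolding power_add by (simp add: mult_le_mono)
  then show ?thesis using assms unfolding poly_bounded_def by blast
qed

text \<open>The additional exponent pays for the factor two. This is why sizes are kept at least 2:
  constants and sums are absorbed into the exponent, and every bound can be a pure power.\<close>

lemma two_powers_le:
  assumes "2 \<le> (h::nat)" shows "h ^ c + h ^ d \<le> h ^ (c + d + 1)"
proof -
  have "h ^ c \<le> h ^ (c + d)" "h ^ d \<le> h ^ (c + d)" using assms by (auto intro!: power_increasing)
  then have "h ^ c + h ^ d \<le> 2 * h ^ (c + d)" by simp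
  also have "\<dots> \<le> h * h ^ (c + d)" using assms by (rule mult_right_mono) simp
  finally show ?thesis by simp
qed

lemma poly_bounded_add:
  assumes "poly_bounded X S a" "poly_bounded X S b" shows "poly_bounded X S (\<lambda>x. a x + b x)"
proof -
  obtain c d where cd: "\<forall>x\<in>X. a x \<le> S x ^ c" "\<forall>x\<in>X. b x \<le> S x ^ d" and S: "\<forall>x\<in>X. 2 \<le> S x"
    using assms unfolding poly_bounded_def by blast
  have "a x + b x \<le> S x ^ (c + d + 1)" if "x \<in> X" for x
    using cd S that two_powers_le[of "S x" c d] by (meson add_mono order_trans)
  then show ?thesis using S unfolding poly_bounded_def by blast
qed

lemma poly_bounded_power:
  assumes "poly_bounded X S a" shows "poly_bounded X S (\<lambda>x. a x ^ n)"
proof -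
  obtain c where "\<forall>x\<in>X. a x \<le> S x ^ c" using assms unfolding poly_bounded_def by blast
  then have "\<forall>x\<in>X. a x ^ n \<le> S x ^ (c * n)" unfolding power_mult by (simp add: power_mono)
  then show ?thesis using assms unfolding poly_bounded_def by blast
qed

definition pb :: "('a::enc \<Rightarrow> nat) \<Rightarrow> bool" where
  "pb b \<longleftrightarrow> poly_bounded UNIV (\<lambda>x. hgt x + 2) b"

lemma pb_iff: "pb b \<longleftrightarrow> (\<exists>c. \<forall>x. b x \<le> (hgt x + 2) ^ c)"
  by (simp add: pb_def poly_bounded_def)

lemma pb_const: "pb (\<lambda>_. n)" unfolding pb_def by (rule poly_bounded_const) simp

lemma pb_hgt: "pb hgt"
  unfolding pb_iff by (rule exI[of _ 1]) simp

lemmas pb_mono = poly_bounded_mono[where X = UNIV and S = "\<lambda>x. hgt x + 2", folded pb_def]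
lemmas pb_add = poly_bounded_add[where X = UNIV and S = "\<lambda>x. hgt x + 2", folded pb_def]
lemmas pb_mult = poly_bounded_mult[where X = UNIV and S = "\<lambda>x. hgt x + 2", folded pb_def]
lemmas pb_power = poly_bounded_power[where X = UNIV and S = "\<lambda>x. hgt x + 2", folded pb_def]

lemmas pb_intros = pb_const pb_add pb_mult pb_power pb_hgt

lemma poly_bounded_compose:
  assumes "pb b" "poly_bounded X S (\<lambda>x. hgt (f x))" shows "poly_bounded X S (\<lambda>x. b (f x))"
proof -
  obtain c where "\<forall>x. b x \<le> (hgt x + 2) ^ c" using assms(1) unfolding pb_iff by blast
  moreover have "poly_bounded X S (\<lambda>x. (hgt (f x) + 2) ^ c)"
    by (intro poly_bounded_power poly_bounded_add poly_bounded_const assms(2))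
       (use assms(2) in \<open>simp add: poly_bounded_def\<close>)
  ultimately show ?thesis by (auto intro: poly_bounded_mono)
qed

lemmas pb_compose = poly_bounded_compose[where X = UNIV and S = "\<lambda>x. hgt x + 2", folded pb_def]

text \<open>Time is measured against the height of the input, which is at most its number of nodes.
  Output heights are then polynomial too (\<open>PH_pb\<close>), and this gives closure under
  composition.\<close>

definition PH :: "('a::enc \<Rightarrow> 'b::enc) \<Rightarrow> bool" where
  "PH f \<longleftrightarrow> (\<exists>c. computes UNIV f (\<lambda>x. (hgt x + 2) ^ c))"

lemma PHI: "computes UNIV f T \<Longrightarrow> pb T \<Longrightarrow> PH f"
  unfolding PH_def pb_iff by (meson computes_mono order_refl)

lemma PHE: assumes "PH f" obtains T where "computes UNIV f T" "pb T"
  using assms unfolding PH_def pb_iff by (meson order_refl)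

lemma PH_pb: "PH f \<Longrightarrow> pb (\<lambda>x. hgt (f x))"
proof (erule PHE)
  fix T assume "computes UNIV f T" "pb T"
  then show ?thesis by (intro pb_mono[OF pb_add[OF pb_hgt \<open>pb T\<close>]]) (simp add: computes_height)
qed

lemma PH_const: "PH (\<lambda>_. y)"
  using computes_const[of UNIV y] PHI pb_const by blast

lemma PH_id: "PH (\<lambda>x. x)"
  by (rule PHI[OF computes_recode pb_const]) simp

lemma PH_compose: "PH g \<Longrightarrow> PH f \<Longrightarrow> PH (\<lambda>x. g (f x))"
proof -
  assume g: "PH g" and f: "PH f"
  obtain T where T: "computes UNIV g T" "pb T" using g PHE by blast
  obtain U where U: "computes UNIV f U" "pb U" using f PHE by blast
  show ?thesis
    by (rule PHI[OF computes_compose[OF U(1) T(1)]]) (auto intro!: pb_intros U(2) pb_compose[OF T(2)] PH_pb f)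
qed

lemma PH_Pair: "PH f \<Longrightarrow> PH g \<Longrightarrow> PH (\<lambda>x. (f x, g x))"
  by (elim PHE, rule PHI[OF computes_Pair], assumption+) (intro pb_intros)

lemma PH_Cons: "PH f \<Longrightarrow> PH g \<Longrightarrow> PH (\<lambda>x. f x # g x)"
  by (elim PHE, rule PHI[OF computes_Cons], assumption+) (intro pb_intros)

lemma PH_If: "PH b \<Longrightarrow> PH f \<Longrightarrow> PH g \<Longrightarrow> PH (\<lambda>x. if b x then f x else g x)"
  by (elim PHE, rule PHI[OF computes_If], assumption+) (intro pb_intros)

lemma PH_fst: "PH f \<Longrightarrow> PH (\<lambda>x. fst (f x))"
  by (rule PH_compose[OF PHI[OF computes_left pb_const]]) (simp_all add: enc_prod_def)

lemma PH_snd: "PH f \<Longrightarrow> PH (\<lambda>x. snd (f x))"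
  by (rule PH_compose[OF PHI[OF computes_right pb_const]]) (simp_all add: enc_prod_def)

lemma PH_tl: "PH f \<Longrightarrow> PH (\<lambda>x. tl (f x))"
proof -
  have *: "enc (tl x) = right (enc x)" for x :: "'b list" by (cases x) auto
  show "PH f \<Longrightarrow> PH (\<lambda>x. tl (f x))" by (rule PH_compose[OF PHI[OF computes_right pb_const]]) (simp_all add: *)
qed

lemma PH_recode: "(\<And>x. enc (h x) = enc x) \<Longrightarrow> PH f \<Longrightarrow> PH (\<lambda>x. h (f x))"
  by (rule PH_compose[OF PHI[OF computes_recode pb_const]]) simp

lemma PH_foldl:
  assumes body: "PH (\<lambda>p. f (fst p) (fst (snd p)) (snd (snd p)))"
    and init: "PH init" and lst: "PH lst"
    and B: "\<And>x ys zs. lst x = ys @ zs \<Longrightarrow> hgt (foldl (f x) (init x) ys) \<le> B x" and "pb B"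
  shows "PH (\<lambda>x. foldl (f x) (init x) (lst x))"
proof -
  obtain c where c: "computes UNIV (\<lambda>p. f (fst p) (fst (snd p)) (snd (snd p))) (\<lambda>p. (hgt p + 2) ^ c)"
    using body unfolding PH_def by blast
  obtain T where T: "computes UNIV init T" "pb T" using init PHE by blast
  obtain U where U: "computes UNIV lst U" "pb U" using lst PHE by blast
  have "pb (\<lambda>x. length (lst x))" by (rule pb_mono[OF PH_pb[OF lst] length_le_hgt])
  then show ?thesis using \<open>pb B\<close>
    by (intro PHI[OF computes_foldl[OF T(1) U(1) c B]] pb_intros PH_pb[OF lst] T(2) U(2))
qed

lemma PH_nonempty:
  assumes "PH l" shows "PH (\<lambda>x. l x \<noteq> [])"
proof (rule PH_compose[OF _ assms])
  have *: "enc (xs \<noteq> []) = enc (if enc xs \<noteq> Leaf then True else False)" for xs :: "'b list" by (cases xs) auto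
  obtain T where T: "computes UNIV (\<lambda>_ :: 'b list. True) (\<lambda>_. T)" using computes_const by blast
  obtain U where U: "computes UNIV (\<lambda>_ :: 'b list. False) (\<lambda>_. U)" using computes_const by blast
  obtain V where "computes UNIV (\<lambda>x :: 'b list. x) V" "pb V" using PH_id PHE by blast
  then have "computes UNIV (\<lambda>x :: 'b list. if enc x \<noteq> Leaf then True else False) (\<lambda>x. V x + (T + U) + 4)"
    using computes_if'[OF _ T U, of V "enc :: 'b list \<Rightarrow> dtree"] by (simp add: computes_def)
  then have "PH (\<lambda>x :: 'b list. if enc x \<noteq> Leaf then True else False)"
    by (rule PHI) (intro pb_intros \<open>pb V\<close>)
  then show "PH (\<lambda>x :: 'b list. x \<noteq> [])" unfolding PH_def computes_def * .
qed


section \<open>List operations and bounded quantifiers\<close>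

lemma PH_rev: assumes "PH l" shows "PH (\<lambda>x. rev (l x))"
proof -
  have *: "foldl (\<lambda>a e. e # a) [] ys = rev ys" for ys :: "'b list"
    by (induction ys rule: rev_induct) auto
  have "PH (\<lambda>x. foldl (\<lambda>a e. e # a) [] (l x))"
  proof (rule PH_foldl[where B = "\<lambda>x. hgt (l x) + hgt (l x)"])
    fix x and ys zs :: "'b list" assume 1: "l x = ys @ zs"
    have "hgt (rev ys) \<le> length (rev ys) + hgt (l x)"
      by (rule hgt_le) (use 1 in \<open>auto intro!: elem_le_hgt\<close>)
    moreover have "length ys \<le> hgt (l x)" using length_le_hgt[of "l x"] 1 by simp
    ultimately show "hgt (foldl (\<lambda>a e. e # a) [] ys) \<le> hgt (l x) + hgt (l x)" unfolding * by simp
  qed (intro PH_Cons PH_fst PH_snd PH_id PH_const assms pb_intros PH_pb)+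
  then show ?thesis by (simp add: *)
qed

lemma PH_map:
  assumes f: "PH (\<lambda>p. f (fst p) (snd p))" and l: "PH l"
  shows "PH (\<lambda>x. map (f x) (l x))"
proof -
  have *: "foldl (\<lambda>a e. f x e # a) [] ys = rev (map (f x) ys)" for x ys
    by (induction ys rule: rev_induct) auto
  obtain c where c: "\<And>p. hgt (f (fst p) (snd p)) \<le> (hgt p + 2) ^ c"
    using PH_pb[OF f] unfolding pb_iff by blast
  let ?B = "\<lambda>x. hgt (l x) + (hgt x + hgt (l x) + 3) ^ c"
  have "PH (\<lambda>x. foldl (\<lambda>a e. f x e # a) [] (l x))"
  proof (rule PH_foldl[where B = ?B])
    fix x ys zs assume 1: "l x = ys @ zs"
    have "hgt (rev (map (f x) ys)) \<le> length (rev (map (f x) ys)) + (hgt x + hgt (l x) + 3) ^ c"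
    proof (rule hgt_le)
      fix z assume "z \<in> set (rev (map (f x) ys))"
      then obtain e where e: "z = f x e" "e \<in> set (l x)" using 1 by auto
      have "hgt z \<le> (hgt (x, e) + 2) ^ c" using c[of "(x, e)"] e by simp
      also have "\<dots> \<le> (hgt x + hgt (l x) + 3) ^ c" using elem_le_hgt[OF e(2)] by (intro power_mono) auto
      finally show "hgt z \<le> (hgt x + hgt (l x) + 3) ^ c" .
    qed
    moreover have "length ys \<le> hgt (l x)" using length_le_hgt[of "l x"] 1 by simp
    ultimately show "hgt (foldl (\<lambda>a e. f x e # a) [] ys) \<le> ?B x" unfolding * by simp
  next
    have "PH (\<lambda>p. f (fst (fst p, snd (snd p))) (snd (fst p, snd (snd p))))"
      by (rule PH_compose[OF f]) (intro PH_Pair PH_fst PH_snd PH_id)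
    then show "PH (\<lambda>p. f (fst p) (snd (snd p)) # fst (snd p))"
      by (intro PH_Cons PH_fst PH_snd PH_id) simp
  qed (intro PH_const l pb_intros PH_pb)+
  from PH_rev[OF this] show ?thesis by (simp add: *)
qed

lemma PH_append: assumes "PH a" "PH b" shows "PH (\<lambda>x. a x @ b x)"
proof -
  have *: "foldl (\<lambda>a e. e # a) zs ys = rev ys @ zs" for ys zs :: "'b list"
    by (induction ys rule: rev_induct) auto
  let ?B = "\<lambda>x. (hgt (a x) + hgt (b x)) + (hgt (a x) + hgt (b x))"
  have "PH (\<lambda>x. foldl (\<lambda>a e. e # a) (b x) (rev (a x)))"
  proof (rule PH_foldl[where B = ?B])
    fix x and ys zs :: "'b list" assume 1: "rev (a x) = ys @ zs"
    have s: "set ys \<subseteq> set (a x)" using 1 by (metis set_append set_rev sup_ge1)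
    have "hgt (rev ys @ b x) \<le> length (rev ys @ b x) + (hgt (a x) + hgt (b x))"
    proof (rule hgt_le)
      fix z assume "z \<in> set (rev ys @ b x)"
      then have "z \<in> set (a x) \<or> z \<in> set (b x)" using s by auto
      then show "hgt z \<le> hgt (a x) + hgt (b x)" using elem_le_hgt[of z "a x"] elem_le_hgt[of z "b x"] by auto
    qed
    moreover have "length ys \<le> hgt (a x)" using length_le_hgt[of "a x"] arg_cong[OF 1, of length] by simp
    moreover have "length (b x) \<le> hgt (b x)" by (rule length_le_hgt)
    ultimately show "hgt (foldl (\<lambda>a e. e # a) (b x) ys) \<le> ?B x" unfolding * by simp
  qed (intro PH_Cons PH_fst PH_snd PH_id PH_rev assms pb_intros PH_pb)+
  then show ?thesis by (simp add: *)
qed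

lemma PH_concat: assumes "PH l" shows "PH (\<lambda>x. concat (l x))"
proof -
  have *: "foldl (@) [] ys = concat ys" for ys :: "'b list list"
    by (induction ys rule: rev_induct) auto
  let ?B = "\<lambda>x. hgt (l x) * hgt (l x) + hgt (l x)"
  have "PH (\<lambda>x. foldl (@) [] (l x))"
  proof (rule PH_foldl[where B = ?B])
    fix x and ys zs :: "'b list list" assume 1: "l x = ys @ zs"
    have "hgt (concat ys) \<le> length (concat ys) + hgt (l x)"
      by (rule hgt_le) (use 1 in \<open>auto intro!: order_trans[OF elem_le_hgt elem_le_hgt]\<close>)
    moreover have "length (concat ys) \<le> hgt (l x) * hgt (l x)"
    proof -
      have "length (concat ys) \<le> length ys * M" if "\<And>z. z \<in> set ys \<Longrightarrow> length z \<le> M" for M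
        using that by (induction ys) (auto intro!: add_mono)
      moreover have "length z \<le> hgt (l x)" if "z \<in> set ys" for z
        by (rule order_trans[OF length_le_hgt elem_le_hgt]) (use that 1 in simp)
      moreover have "length ys \<le> hgt (l x)" using length_le_hgt[of "l x"] 1 by simp
      ultimately show ?thesis by (meson mult_le_mono1 order_trans)
    qed
    ultimately show "hgt (foldl (@) [] ys) \<le> ?B x" unfolding * by simp
  qed (intro PH_append PH_fst PH_snd PH_id PH_const assms pb_intros PH_pb)+
  then show ?thesis by (simp add: *)
qed

lemma PH_filter:
  assumes "PH (\<lambda>p. P (fst p) (snd p))" "PH l" shows "PH (\<lambda>x. filter (P x) (l x))"
proof -
  have *: "concat (map (\<lambda>y. if Q y then [y] else []) ys) = filter Q ys" for Q and ys :: "'b list"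
    by (induction ys) auto
  have "PH (\<lambda>x. concat (map (\<lambda>y. if P x y then [y] else []) (l x)))"
    by (intro PH_concat PH_map PH_If assms PH_Cons PH_snd PH_id PH_const)
  then show ?thesis by (simp add: *)
qed

lemma PH_Not: "PH b \<Longrightarrow> PH (\<lambda>x. \<not> b x)"
proof -
  have "(\<lambda>x. \<not> b x) = (\<lambda>x. if b x then False else True)" by auto
  then show "PH b \<Longrightarrow> PH (\<lambda>x. \<not> b x)" by (simp only: PH_If PH_const)
qed

lemma PH_conj: "PH a \<Longrightarrow> PH b \<Longrightarrow> PH (\<lambda>x. a x \<and> b x)"
proof -
  have "(\<lambda>x. a x \<and> b x) = (\<lambda>x. if a x then b x else False)" by auto
  then show "PH a \<Longrightarrow> PH b \<Longrightarrow> PH (\<lambda>x. a x \<and> b x)" by (simp only: PH_If PH_const)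
qed

lemma PH_disj: "PH a \<Longrightarrow> PH b \<Longrightarrow> PH (\<lambda>x. a x \<or> b x)"
  using PH_Not[OF PH_conj[OF PH_Not PH_Not], of a b] by simp

lemma PH_Bex:
  assumes "PH (\<lambda>p. P (fst p) (snd p))" "PH l" shows "PH (\<lambda>x. \<exists>y\<in>set (l x). P x y)"
  using PH_nonempty[OF PH_filter[OF assms]] by (simp add: filter_empty_conv)

lemma PH_Ball:
  assumes "PH (\<lambda>p. P (fst p) (snd p))" "PH l" shows "PH (\<lambda>x. \<forall>y\<in>set (l x). P x y)"
  using PH_Not[OF PH_Bex[OF PH_Not[OF assms(1)] assms(2)]] by simp

section \<open>Arithmetic on unary numbers\<close>

lemma PH_units: "PH n \<Longrightarrow> PH (\<lambda>x. replicate (n x) ())"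
proof (erule PH_recode[rotated])
  show "enc (replicate n ()) = enc n" for n by (induction n) auto
qed

text \<open>A unary number and a list of units have the same tree, so iteration is a fold over
  units. All iterates must stay polynomially high, which rules out repeated doubling but allows
  repeated addition, decrementing and halving.\<close>

lemma PH_funpow:
  fixes f :: "'a::enc \<Rightarrow> 'b::enc \<Rightarrow> 'b"
  assumes f: "PH (\<lambda>p. f (fst p) (snd p))" and "PH a" "PH n"
    and B: "\<And>x i. i \<le> n x \<Longrightarrow> hgt ((f x ^^ i) (a x)) \<le> B x" "pb B"
  shows "PH (\<lambda>x. (f x ^^ n x) (a x))"
proof -
  have *: "foldl (\<lambda>a _. g a) a ys = (g ^^ length ys) a" for g :: "'b \<Rightarrow> 'b" and a and ys :: "unit list"
    by (induction ys rule: rev_induct) auto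
  have "PH (\<lambda>x. foldl (\<lambda>a _. f x a) (a x) (replicate (n x) ()))"
  proof (rule PH_foldl[where B = B])
    fix x ys zs assume "replicate (n x) () = ys @ zs"
    then have "length ys \<le> n x" by (metis length_append length_replicate le_add1)
    then show "hgt (foldl (\<lambda>a _. f x a) (a x) ys) \<le> B x" unfolding * by (rule B(1))
  next
    have "PH (\<lambda>p. f (fst (fst p, fst (snd p))) (snd (fst p, fst (snd p))))"
      by (rule PH_compose[OF f]) (intro PH_Pair PH_fst PH_snd PH_id)
    then show "PH (\<lambda>p. f (fst p) (fst (snd p)))" by simp
  qed (intro assms PH_units)+
  then show ?thesis by (simp add: *)
qed

lemma PH_length: "PH l \<Longrightarrow> PH (\<lambda>x. length (l x))"
proof -
  assume l: "PH l"
  have *: "enc (length us) = enc us" for us :: "unit list" by (induction us) auto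
  have "PH (\<lambda>x. length (map (\<lambda>_. ()) (l x)))"
    by (rule PH_recode[OF *]) (intro PH_map PH_const l)
  then show ?thesis by simp
qed

lemma PH_Suc: "PH n \<Longrightarrow> PH (\<lambda>x. Suc (n x))"
  using PH_recode[of "\<lambda>p :: unit \<times> nat. Suc (snd p)" "\<lambda>x. ((), n x)"] PH_Pair[OF PH_const, of n "()"]
  by (simp add: enc_prod_def)

lemma PH_pred: assumes "PH n" shows "PH (\<lambda>x. n x - (1::nat))"
proof -
  have *: "enc (n - 1) = right (enc n)" for n :: nat by (cases n) auto
  have "PH (\<lambda>n :: nat. n - 1)" by (rule PHI[OF computes_right pb_const]) (rule *)
  from PH_compose[OF this assms] show ?thesis .
qed

lemma PH_nat_pb: "PH n \<Longrightarrow> pb n"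
  using PH_pb[of n] by simp

lemma PH_add:
  fixes a b :: "'a::enc \<Rightarrow> nat"
  assumes "PH a" "PH b" shows "PH (\<lambda>x. a x + b x)"
proof -
  have *: "(Suc ^^ i) m = m + i" for i m by (induction i) auto
  have "PH (\<lambda>x. (Suc ^^ b x) (a x))"
    by (rule PH_funpow[where B = "\<lambda>x. a x + b x", OF PH_Suc[OF PH_snd[OF PH_id]] assms])
       (simp_all add: * pb_add PH_nat_pb assms)
  then show ?thesis unfolding * .
qed

lemma PH_diff:
  fixes a b :: "'a::enc \<Rightarrow> nat"
  assumes "PH a" "PH b" shows "PH (\<lambda>x. a x - b x)"
proof -
  have *: "((\<lambda>n. n - 1) ^^ i) m = m - i" for i m :: nat by (induction i) auto
  have "PH (\<lambda>x. ((\<lambda>n. n - 1) ^^ b x) (a x))"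
    by (rule PH_funpow[where B = a, OF PH_pred[OF PH_snd[OF PH_id]] assms])
       (simp_all only: *, simp_all add: PH_nat_pb assms)
  then show ?thesis unfolding * .
qed

lemma PH_mult:
  fixes a b :: "'a::enc \<Rightarrow> nat"
  assumes "PH a" "PH b" shows "PH (\<lambda>x. a x * b x)"
proof -
  have *: "((\<lambda>n. n + m) ^^ i) 0 = m * i" for i m :: nat by (induction i) auto
  have 1: "PH (\<lambda>p. a (fst p))" by (rule PH_compose[OF assms(1) PH_fst[OF PH_id]])
  have "PH (\<lambda>x. ((\<lambda>n. n + a x) ^^ b x) 0)"
    by (rule PH_funpow[where B = "\<lambda>x. a x * b x", OF PH_add[OF PH_snd[OF PH_id] 1] PH_const assms(2)])
       (simp_all add: * pb_mult PH_nat_pb assms)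
  then show ?thesis unfolding * .
qed

lemma PH_power: "PH (a :: _ \<Rightarrow> nat) \<Longrightarrow> PH (\<lambda>x. a x ^ n)"
  by (induction n) (simp_all add: PH_const PH_mult)

lemma PH_le:
  fixes a b :: "'a::enc \<Rightarrow> nat"
  assumes "PH a" "PH b" shows "PH (\<lambda>x. (a x :: nat) \<le> b x)"
proof -
  have "(replicate (a x - b x) () \<noteq> []) = (\<not> a x \<le> b x)" for x by auto
  then show ?thesis using PH_Not[OF PH_nonempty[OF PH_units[OF PH_diff[OF assms]]]] by simp
qed

lemma PH_less:
  fixes a b :: "'a::enc \<Rightarrow> nat"
  assumes "PH a" "PH b" shows "PH (\<lambda>x. (a x :: nat) < b x)"
  using PH_Not[OF PH_le[OF assms(2,1)]] by (simp add: not_le)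

lemma PH_eq:
  fixes a b :: "'a::enc \<Rightarrow> nat"
  assumes "PH a" "PH b" shows "PH (\<lambda>x. (a x :: nat) = b x)"
  using PH_conj[OF PH_le[OF assms] PH_le[OF assms(2,1)]] by (simp add: order_eq_iff)

lemma PH_min: "PH a \<Longrightarrow> PH b \<Longrightarrow> PH (\<lambda>x. min (a x :: nat) (b x))"
  unfolding min_def by (intro PH_If PH_le)

lemma PH_upt: assumes "PH n" shows "PH (\<lambda>x. [0..<n x])"
proof -
  have *: "((\<lambda>l. l @ [length l]) ^^ i) [] = [0..<i]" for i by (induction i) auto
  have "PH (\<lambda>x. ((\<lambda>l. l @ [length l]) ^^ n x) [])"
  proof (rule PH_funpow[where B = "\<lambda>x. n x + n x"])
    fix x i assume i: "i \<le> n x"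
    have "hgt [0..<i] \<le> length [0..<i] + n x" by (rule hgt_le) (use i in auto)
    then show "hgt (((\<lambda>l. l @ [length l]) ^^ i) []) \<le> n x + n x" unfolding * using i by simp
  qed (intro PH_append PH_length PH_Cons PH_snd PH_id PH_const assms pb_intros PH_nat_pb)+
  then show ?thesis unfolding * .
qed

lemma hgt_tl: "hgt (tl xs) \<le> hgt xs" by (cases xs) auto

lemma hgt_drop: "hgt (drop i xs) \<le> hgt xs"
proof (induction i)
  case (Suc i) then show ?case using hgt_tl[of "drop i xs"] by (simp add: drop_Suc tl_drop)
qed simp

lemma PH_drop: assumes "PH n" "PH l" shows "PH (\<lambda>x. drop (n x) (l x))"
proof -
  have *: "(tl ^^ i) xs = drop i xs" for i and xs :: "'b list" by (induction i) (auto simp: drop_Suc tl_drop)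
  have "PH (\<lambda>x. (tl ^^ n x) (l x))"
    by (rule PH_funpow[where B = "\<lambda>x. hgt (l x)"]) (simp_all add: * hgt_drop PH_tl PH_snd PH_id assms PH_pb)
  then show ?thesis unfolding * .
qed

lemma PH_take: assumes "PH n" "PH l" shows "PH (\<lambda>x. take (n x) (l x))"
proof -
  have "PH (\<lambda>x. rev (drop (length (l x) - n x) (rev (l x))))"
    by (intro PH_rev PH_drop PH_diff PH_length assms)
  moreover have "rev (drop (length xs - m) (rev xs)) = take m xs" for m and xs :: "'b list"
    by (metis rev_rev_ident take_rev rev_take length_rev)
  ultimately show ?thesis by simp
qed

text \<open>A total indexing operation: verification looks up positions taken from an arbitrary
  program output, and a program computing the function needs a definite value everywhere.\<close>

definition nth_or :: "'a \<Rightarrow> 'a list \<Rightarrow> nat \<Rightarrow> 'a" where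
  "nth_or d l i = (if i < length l then l ! i else d)"

lemma PH_nth_or: assumes "PH l" "PH n" shows "PH (\<lambda>x. nth_or d (l x) (n x))"
proof -
  have *: "foldl (\<lambda>_ e. e) d ys = (if ys = [] then d else last ys)" for ys :: "'b list"
    by (induction ys rule: rev_induct) auto
  have "PH (\<lambda>x. foldl (\<lambda>_ e. e) d (rev (drop (n x) (l x))))"
  proof (rule PH_foldl[where B = "\<lambda>x. hgt d + hgt (l x)"])
    fix x and ys zs :: "'b list" assume 1: "rev (drop (n x) (l x)) = ys @ zs"
    have "set ys \<subseteq> set (rev (drop (n x) (l x)))" unfolding 1 by simp
    then have "ys \<noteq> [] \<Longrightarrow> last ys \<in> set (l x)" using set_drop_subset by (force simp: in_mono)
    then show "hgt (foldl (\<lambda>_ e. e) d ys) \<le> hgt d + hgt (l x)" unfolding *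
      using elem_le_hgt[of "last ys" "l x"] by auto
  qed (intro PH_rev PH_drop PH_snd PH_id PH_const assms pb_intros PH_pb)+
  moreover have "foldl (\<lambda>_ e. e) d (rev (drop i l)) = nth_or d l i" for l :: "'b list" and i
    unfolding * by (auto simp: nth_or_def last_rev hd_drop_conv_nth)
  ultimately show ?thesis by simp
qed

lemma length_filter_less_upt: "length (filter (\<lambda>i. i < m) [0..<n]) = min m n"
  by (induction n) (auto simp: min_def)

text \<open>The half of \<open>m\<close> is the number of \<open>i\<close> with
  \<open>2 * (i + 1)\<close> at most \<open>m\<close>. Counting the solutions of a monotone
  condition in a bounded range also yields binary lengths and integer roots later on.\<close>

lemma PH_half:
  fixes n :: "'a::enc \<Rightarrow> nat"
  assumes "PH n" shows "PH (\<lambda>x. n x div 2)"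
proof -
  have "length (filter (\<lambda>i. 2 * Suc i \<le> m) [0..<m]) = m div 2" for m
  proof -
    have "(2 * Suc i \<le> m) = (i < m div 2)" for i by presburger
    then show ?thesis by (simp add: length_filter_less_upt)
  qed
  moreover have "PH (\<lambda>x. length (filter (\<lambda>i. 2 * Suc i \<le> n x) [0..<n x]))"
    by (intro PH_length PH_filter PH_le PH_mult PH_Suc PH_snd PH_id PH_const PH_upt assms PH_compose[OF assms] PH_fst)
  ultimately show ?thesis by simp
qed

lemma PH_div_pow2:
  fixes a n :: "'a::enc \<Rightarrow> nat"
  assumes "PH a" "PH n" shows "PH (\<lambda>x. a x div 2 ^ n x)"
proof -
  have *: "((\<lambda>m. m div 2) ^^ i) m = m div 2 ^ i" for i m :: nat
    by (induction i) (simp_all add: div_mult2_eq[symmetric] mult.commute)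
  have "PH (\<lambda>x. ((\<lambda>m. m div 2) ^^ n x) (a x))"
    by (rule PH_funpow[where B = a]) (simp_all add: * PH_half PH_snd PH_id assms PH_nat_pb)
  then show ?thesis unfolding * .
qed

lemma PH_odd: assumes "PH n" shows "PH (\<lambda>x. odd (n x :: nat))"
proof -
  have "(\<lambda>x. odd (n x)) = (\<lambda>x. \<not> n x = 2 * (n x div 2))"
    by (rule ext) presburger
  moreover have "PH (\<lambda>x. \<not> n x = 2 * (n x div 2))"
    by (rule PH_Not[OF PH_eq[OF assms PH_mult[OF PH_const PH_half[OF assms]]]])
  ultimately show ?thesis by (simp only:)
qed


text \<open>The truncations below keep all intermediate results small, so that the functions run in
  polynomial time on all inputs.\<close>

definition cap_pow :: "nat \<Rightarrow> nat \<Rightarrow> nat \<Rightarrow> nat" where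
  "cap_pow c x n = ((\<lambda>a. min (a * x) c) ^^ n) (min 1 c)"

text \<open>Truncating in every round agrees with truncating once at the end: a positive factor
  cannot bring a value back below \<open>c\<close>, and the factor zero is treated apart.\<close>

lemma cap_pow: "cap_pow c x n = min (x ^ n) c"
proof -
  have "((\<lambda>a. min (a * x) c) ^^ n) (min 1 c) = min (x ^ n) c"
  proof (induction n)
    case (Suc n)
    have "((\<lambda>a. min (a * x) c) ^^ Suc n) (min 1 c) = min (min (x ^ n) c * x) c" using Suc by simp
    also have "\<dots> = min (x ^ n * x) c"
    proof (cases "x ^ n \<le> c \<or> x = 0")
      case True then show ?thesis by (auto simp: min_def)
    next
      case False
      then have "c \<le> c * x" "c * x \<le> x ^ n * x" by auto
      then have "c \<le> x ^ n * x" by linarith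
      then show ?thesis using False \<open>c \<le> c * x\<close> by (simp add: min_absorb2)
    qed
    finally show ?case by (simp add: mult.commute)
  qed simp
  then show ?thesis by (simp add: cap_pow_def)
qed

lemma PH_cap_pow: assumes "PH c" "PH x" "PH n" shows "PH (\<lambda>e. cap_pow (c e) (x e) (n e))"
  unfolding cap_pow_def
proof (rule PH_funpow[where B = c])
  show "PH (\<lambda>p. min (snd p * x (fst p)) (c (fst p)))"
    by (intro PH_min PH_mult PH_snd PH_id PH_compose[OF assms(1)] PH_compose[OF assms(2)] PH_fst)
  show "hgt (((\<lambda>a. min (a * x e) (c e)) ^^ i) (min 1 (c e))) \<le> c e" for e i
    by (cases i) simp_all
qed (intro PH_min PH_const assms PH_nat_pb)+

definition choices :: "nat \<Rightarrow> 'a list \<Rightarrow> 'b list \<Rightarrow> ('a \<times> 'b) list list" where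
  "choices c A U = foldl (\<lambda>es a. take c (concat (map (\<lambda>e. map (\<lambda>u. (a, u) # e) U) es))) [[]] A"

lemma choices_append1:
  "choices c (A @ [a]) U = take c (concat (map (\<lambda>e. map (\<lambda>u. (a, u) # e) U) (choices c A U)))"
  by (simp add: choices_def)

text \<open>The maximum with 1 accounts for the initial list \<open>[[]]\<close>, which is not
  truncated.\<close>

lemma length_choices: "length (choices c A U) \<le> max 1 c"
  by (cases A rule: rev_cases) (simp_all add: choices_append1, simp add: choices_def)

lemma choices_map_fst: "e \<in> set (choices c A U) \<Longrightarrow> map fst e = rev A"
proof (induction A arbitrary: e rule: rev_induct)
  case (snoc a A) then show ?case by (auto simp: choices_append1 dest!: in_set_takeD)
qed (simp add: choices_def)

lemma choices_length: "e \<in> set (choices c A U) \<Longrightarrow> length e = length A"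
  using choices_map_fst[of e c A U] by (metis length_map length_rev)

lemma choices_elem: "e \<in> set (choices c A U) \<Longrightarrow> p \<in> set e \<Longrightarrow> fst p \<in> set A \<and> snd p \<in> set U"
proof (induction A arbitrary: e rule: rev_induct)
  case (snoc a A) then show ?case by (fastforce simp: choices_append1 dest!: in_set_takeD)
qed (simp add: choices_def)

lemma choices_total: "e \<in> set (choices c A U) \<Longrightarrow> a \<in> set A \<Longrightarrow> \<exists>u\<in>set U. (a, u) \<in> set e"
proof (induction A arbitrary: e rule: rev_induct)
  case (snoc a' A) then show ?case by (fastforce simp: choices_append1 dest!: in_set_takeD)
qed (simp add: choices_def)

lemma length_choices_le: "length (choices c A U) \<le> length U ^ length A"
proof (induction A rule: rev_induct)
  case (snoc a A)
  have "length (concat (map (\<lambda>e. map (\<lambda>u. (a, u) # e) U) (choices c A U))) = length (choices c A U) * length U"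
    by (simp add: length_concat comp_def sum_list_triv)
  also have "\<dots> \<le> length U ^ length A * length U" using snoc by (rule mult_right_mono) simp
  finally show ?case by (simp add: choices_append1 min_le_iff_disj mult.commute)
qed (simp add: choices_def)

text \<open>The numbers of partial functions never exceed the final one, so under the first
  assumption no \<open>take\<close> removes anything. Each new key is put in front, whence the
  reversal.\<close>

lemma choices_complete:
  assumes "length U ^ length A \<le> c" "\<And>a. a \<in> set A \<Longrightarrow> g a \<in> set U"
  shows "rev (map (\<lambda>a. (a, g a)) A) \<in> set (choices c A U)"
  using assms
proof (induction A rule: rev_induct)
  case (snoc a A)
  have U: "1 \<le> length U" using snoc.prems(2)[of a] by (cases U) auto
  have le: "length (choices c A U) * length U \<le> c"
    using mult_right_mono[OF length_choices_le[of c A U], of "length U"] snoc.prems(1)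
    by (metis (no_types, lifting) length_append_singleton order_trans power_Suc2 zero_le)
  have "length U ^ length A \<le> length U ^ length (A @ [a])" using U by (intro power_increasing) auto
  then have "length U ^ length A \<le> c" using snoc.prems(1) by linarith
  then have IH: "rev (map (\<lambda>a. (a, g a)) A) \<in> set (choices c A U)"
    using snoc.prems(2) by (intro snoc.IH) auto
  have "length (concat (map (\<lambda>e. map (\<lambda>u. (a, u) # e) U) (choices c A U))) \<le> c"
    using le by (simp add: length_concat comp_def sum_list_triv mult.commute)
  then have "set (choices c (A @ [a]) U) = set (concat (map (\<lambda>e. map (\<lambda>u. (a, u) # e) U) (choices c A U)))"
    by (simp add: choices_append1)
  also have "\<dots> = (\<Union>e\<in>set (choices c A U). (\<lambda>u. (a, u) # e) ` set U)" by simp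
  finally show ?case using IH snoc.prems(2)[of a] by auto
qed (simp add: choices_def)

lemma PH_choices:
  assumes "PH c" "PH A" "PH U" shows "PH (\<lambda>x. choices (c x) (A x) (U x))"
  unfolding choices_def
proof (rule PH_foldl)
  let ?B = "\<lambda>x. Suc (c x) + (hgt (A x) + Suc (hgt (A x) + hgt (U x)))"
  show "pb ?B" unfolding Suc_eq_plus1 by (intro pb_add pb_const PH_pb PH_nat_pb assms)
  fix x ys zs assume 1: "A x = ys @ zs"
  have "foldl (\<lambda>es a. take (c x) (concat (map (\<lambda>e. map (\<lambda>u. (a, u) # e) (U x)) es))) [[]] ys = choices (c x) ys (U x)"
    by (simp add: choices_def)
  moreover have "hgt (choices (c x) ys (U x)) \<le> length (choices (c x) ys (U x)) + (hgt (A x) + Suc (hgt (A x) + hgt (U x)))"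
  proof (rule hgt_le)
    fix e assume e: "e \<in> set (choices (c x) ys (U x))"
    have "hgt e \<le> length e + Suc (hgt (A x) + hgt (U x))"
    proof (rule hgt_le)
      fix p assume "p \<in> set e"
      from choices_elem[OF e this] have "fst p \<in> set (A x)" "snd p \<in> set (U x)" using 1 by auto
      from elem_le_hgt[OF this(1)] elem_le_hgt[OF this(2)] show "hgt p \<le> Suc (hgt (A x) + hgt (U x))"
        by (simp add: enc_prod_def)
    qed
    moreover have "length e \<le> hgt (A x)" using choices_length[OF e] 1 length_le_hgt[of "A x"] by simp
    ultimately show "hgt e \<le> hgt (A x) + Suc (hgt (A x) + hgt (U x))" by simp
  qed
  ultimately show "hgt (foldl (\<lambda>es a. take (c x) (concat (map (\<lambda>e. map (\<lambda>u. (a, u) # e) (U x)) es))) [[]] ys) \<le> ?B x"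
    using length_choices[of "c x" ys "U x"] by simp
qed (intro PH_take PH_concat PH_map PH_Cons PH_Pair PH_snd PH_fst PH_id PH_const assms
      PH_compose[OF assms(1)] PH_compose[OF assms(3)])+


section \<open>Computability without a time bound, and exponentiation\<close>

definition Cmp :: "('a::enc \<Rightarrow> 'b::enc) \<Rightarrow> bool" where
  "Cmp f \<longleftrightarrow> (\<exists>T. computes UNIV f T)"

lemma PH_Cmp: "PH f \<Longrightarrow> Cmp f"
  unfolding PH_def Cmp_def by blast

lemma Cmp_compose: "Cmp g \<Longrightarrow> Cmp f \<Longrightarrow> Cmp (\<lambda>x. g (f x))"
  unfolding Cmp_def using computes_compose[of UNIV f _ UNIV g] by blast

lemma Cmp_Pair: "Cmp f \<Longrightarrow> Cmp g \<Longrightarrow> Cmp (\<lambda>x. (f x, g x))"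
  unfolding Cmp_def using computes_Pair by blast

lemma Cmp_mult: "Cmp f \<Longrightarrow> Cmp g \<Longrightarrow> Cmp (\<lambda>x. f x * g x :: nat)"
  using Cmp_compose[OF PH_Cmp[OF PH_mult[OF PH_fst[OF PH_id] PH_snd[OF PH_id]]] Cmp_Pair, of f g] by simp

lemma Cmp_add: "Cmp f \<Longrightarrow> Cmp g \<Longrightarrow> Cmp (\<lambda>x. f x + g x :: nat)"
  using Cmp_compose[OF PH_Cmp[OF PH_add[OF PH_fst[OF PH_id] PH_snd[OF PH_id]]] Cmp_Pair, of f g] by simp

lemma Cmp_power: "Cmp f \<Longrightarrow> Cmp (\<lambda>x. f x ^ n :: nat)"
  using Cmp_compose[OF PH_Cmp[OF PH_power[OF PH_id]]] by blast

lemma computable_Cmp: assumes "computable T" shows "Cmp T"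
proof -
  obtain P t where P: "\<And>k. runs P (enc_nat k) (t k) (enc_nat (T k))"
    using assms unfolding computable_def by metis
  have "computes UNIV T (\<lambda>k. t k + Suc (vbound P) + 1)"
    unfolding computes_def enc_nat_def[abs_def]
    using runs_maps[OF P, of "Suc (vbound P)"] by (metis le_SucI order_refl zero_less_Suc)
  then show ?thesis unfolding Cmp_def by blast
qed

lemma Cmp_computable: "Cmp T \<Longrightarrow> computable T"
  unfolding Cmp_def computes_def computable_def enc_nat_def[abs_def] by (metis UNIV_I maps_runs)

text \<open>The result is exponentially high, so this is no polynomial-time function; but its time
  is polynomial in the value produced. That is the form in which the cost of the padding is
  accounted for.\<close>

lemma computes_pow2: "\<exists>c. computes UNIV (\<lambda>n :: nat. (2::nat) ^ n) (\<lambda>n. (2 ^ n + n + 2) ^ c)"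
proof -
  have 1: "PH (\<lambda>p :: nat \<times> nat \<times> unit. fst (snd p) + fst (snd p))"
    by (intro PH_add PH_fst PH_snd PH_id)
  then obtain c where c: "computes UNIV (\<lambda>p :: nat \<times> nat \<times> unit. fst (snd p) + fst (snd p)) (\<lambda>p. (hgt p + 2) ^ c)"
    unfolding PH_def by blast
  obtain T where T: "computes UNIV (\<lambda>_ :: nat. 1 :: nat) (\<lambda>_. T)" using computes_const by blast
  obtain U where U: "computes UNIV (\<lambda>n. replicate n ()) U" "pb U" using PH_units[OF PH_id] PHE by blast
  have *: "foldl (\<lambda>a _. a + a) 1 ys = (2::nat) ^ length ys" for ys :: "unit list"
    by (induction ys rule: rev_induct) auto
  have h: "hgt (replicate n ()) = n" for n by (induction n) auto
  have "computes UNIV (\<lambda>n. foldl (\<lambda>a _. a + a) (1 :: nat) (replicate n ()))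
    (\<lambda>n. T + U n + length (replicate n ()) * ((hgt n + 2 ^ n + hgt (replicate n ()) + 4) ^ c + 6) + 6)"
  proof (rule computes_foldl[where f = "\<lambda>_ a _. a + a" and B = "\<lambda>n. 2 ^ n", OF T U(1) c])
    fix n ys zs assume "replicate n () = ys @ zs"
    then have "length ys \<le> n" by (metis length_append length_replicate le_add1)
    then show "hgt (foldl (\<lambda>a _. a + a) (1::nat) ys) \<le> 2 ^ n" unfolding * by simp
  qed
  then have 2: "computes UNIV (\<lambda>n :: nat. (2::nat) ^ n) (\<lambda>n. T + U n + n * ((n + 2 ^ n + n + 4) ^ c + 6) + 6)"
    unfolding * h length_replicate hgt_nat .
  obtain d where d: "\<And>n. U n \<le> (n + 2) ^ d" using U(2) unfolding pb_iff by auto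
  \<comment> \<open>With \<open>y = 2 ^ n + n\<close> the time becomes a polynomial in the single
    number \<open>y\<close>, and the closure rules supply one exponent \<open>b\<close>.\<close>
  have "pb (\<lambda>y :: nat. y)" using pb_hgt[where 'a = nat] by simp
  then have "pb (\<lambda>y :: nat. T + (y + 2) ^ d + y * ((y + y + 4) ^ c + 6) + 6)" by (intro pb_intros)
  then obtain b where b: "\<And>y :: nat. T + (y + 2) ^ d + y * ((y + y + 4) ^ c + 6) + 6 \<le> (y + 2) ^ b"
    unfolding pb_iff by auto
  have "T + U n + n * ((n + 2 ^ n + n + 4) ^ c + 6) + 6 \<le> (2 ^ n + n + 2) ^ b" for n
  proof -
    have "U n \<le> (2 ^ n + n + 2) ^ d" by (rule order_trans[OF d power_mono]) auto
    moreover have "n * ((n + 2 ^ n + n + 4) ^ c + 6) \<le> (2 ^ n + n) * (((2 ^ n + n) + (2 ^ n + n) + 4) ^ c + 6)"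
      by (intro mult_le_mono add_le_mono1 power_mono) auto
    ultimately show ?thesis using b[of "2 ^ n + n"] by linarith
  qed
  with 2 show ?thesis by (meson computes_mono subset_UNIV)
qed


section \<open>The reduction from clique to dominating set\<close>

text \<open>Coordinates come as a list because repetitions count: a repeated coordinate acts as a
  weight, and it is the choice of weights that achieves injectivity.\<close>

definition ones :: "nat list \<Rightarrow> nat \<Rightarrow> nat" where
  "ones g u = length (filter (\<lambda>l. odd (u div 2 ^ l)) g)"

lemma differing_bit:
  fixes x y :: nat
  assumes "x < 2 ^ L" "y < 2 ^ L" "x \<noteq> y"
  shows "\<exists>l<L. odd (x div 2 ^ l) \<noteq> odd (y div 2 ^ l)"
proof -
  obtain l where l: "odd (x div 2 ^ l) \<noteq> odd (y div 2 ^ l)"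
    using assms(3) bit_eq_iff[of x y] by (auto simp: bit_iff_odd)
  have "l < L"
  proof (rule ccontr)
    assume "\<not> l < L"
    then have "(2::nat) ^ L \<le> 2 ^ l" by (simp add: power_increasing)
    then have "x < 2 ^ l" "y < 2 ^ l" using assms by linarith+
    then have "x div 2 ^ l = 0" "y div 2 ^ l = 0" by simp_all
    then show False using l by simp
  qed
  with l show ?thesis by blast
qed

text \<open>If the new vertex \<open>y\<close> collides with some \<open>z\<close>, add a coordinate
  separating them; each pair rules out at most one multiplicity of that coordinate, as its two
  counts differ by a fixed amount.\<close>

lemma ones_inj:
  assumes "finite Y" "\<And>y. y \<in> Y \<Longrightarrow> y < 2 ^ L"
  shows "\<exists>g. set g \<subseteq> {..<L} \<and> length g \<le> card Y ^ 3 \<and> inj_on (ones g) Y"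
  using assms
proof (induction Y rule: finite_induct)
  case empty then show ?case by (intro exI[of _ "[]"]) auto
next
  case (insert y Y)
  then obtain g where g: "set g \<subseteq> {..<L}" "length g \<le> card Y ^ 3" "inj_on (ones g) Y" by auto
  let ?Y = "insert y Y"
  \<comment> \<open>The cubic bound leaves room for \<open>card ?Y ^ 2\<close> further coordinates
    whenever one element is inserted.\<close>
  have len: "card Y ^ 3 + card ?Y ^ 2 \<le> card ?Y ^ 3"
    using insert.hyps by (simp add: power2_eq_square power3_eq_cube algebra_simps)
  show ?case
  proof (cases "ones g y \<in> ones g ` Y")
    case False
    then have "inj_on (ones g) ?Y" using g(3) by auto
    then show ?thesis using g len by (intro exI[of _ g]) auto
  next
    case True
    then obtain z where z: "z \<in> Y" "ones g y = ones g z" by auto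
    then have "y \<noteq> z" using insert.hyps by auto
    with differing_bit[of y L z] insert.prems z obtain l where l: "l < L" "odd (y div 2 ^ l) \<noteq> odd (z div 2 ^ l)" by auto
    \<comment> \<open>These include all weights \<open>c\<close> for which some \<open>a\<close>
      with bit \<open>l\<close> set would collide with some \<open>b\<close> without it. At most
      \<open>card ?Y ^ 2\<close> values are bad, against one more candidate.\<close>
    let ?bad = "(\<lambda>(a, b). ones g b - ones g a) ` (?Y \<times> ?Y)"
    have "card ?bad \<le> card (?Y \<times> ?Y)" using insert.hyps by (intro card_image_le) auto
    also have "\<dots> < card {..card ?Y ^ 2}" unfolding card_cartesian_product power2_eq_square by simp
    finally have "card ?bad < card {..card ?Y ^ 2}" .
    then have "\<not> {..card ?Y ^ 2} \<subseteq> ?bad" using insert.hyps by (metis card_mono finite_SigmaI finite_imageI finite_insert leD)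
    then obtain c where c: "c \<le> card ?Y ^ 2" "c \<notin> ?bad" unfolding subset_iff atMost_iff by blast
    let ?g = "replicate c l @ g"
    have ones: "ones ?g u = (if odd (u div 2 ^ l) then c else 0) + ones g u" for u
      by (simp add: ones_def)
    have neq: "ones ?g a \<noteq> ones ?g b" if "a \<in> ?Y" "b \<in> ?Y" "odd (a div 2 ^ l)" "even (b div 2 ^ l)" for a b
    proof
      assume "ones ?g a = ones ?g b"
      then have "c = ones g b - ones g a" using that unfolding ones by simp
      with c(2) that show False by auto
    qed
    have "inj_on (ones ?g) ?Y"
    \<comment> \<open>The choice of \<open>c\<close> handles pairs that differ in bit
      \<open>l\<close>. A pair with equal bits would already collide under \<open>g\<close>; the
      only such pair is \<open>y\<close> and \<open>z\<close>, and these differ in bit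
      \<open>l\<close>.\<close>
    proof (rule inj_onI, rule ccontr)
      fix a b assume ab: "a \<in> ?Y" "b \<in> ?Y" "ones ?g a = ones ?g b" "a \<noteq> b"
      then have bit: "odd (a div 2 ^ l) = odd (b div 2 ^ l)" using neq[of a b] neq[of b a] by auto
      then have eq: "ones g a = ones g b" using ab(3) unfolding ones by simp
      have "a = z" if "b = y"
        using that ab g(3) z eq by (metis inj_onD insertE)
      moreover have "b = z" if "a = y"
        using that ab g(3) z eq by (metis inj_onD insertE)
      moreover have "a = y \<or> b = y" using ab g(3) eq by (metis inj_onD insertE)
      ultimately show False using bit l(2) by auto
    qed
    moreover have "length ?g \<le> card ?Y ^ 3" using c g len by simp
    ultimately show ?thesis using g l by (intro exI[of _ ?g]) (auto simp: set_replicate_conv_if)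
  qed
qed

text \<open>The same count as \<open>ones\<close>, for a hash function in the form in which
  \<open>choices\<close> enumerates it: an entry \<open>(t, l)\<close> says that coordinate number
  \<open>t\<close> is bit \<open>l\<close>.\<close>

definition val :: "(nat \<times> nat) list \<Rightarrow> nat \<Rightarrow> nat" where
  "val i u = length (filter (\<lambda>p. odd (u div 2 ^ snd p)) i)"

lemma val_ones: "val (rev (map (\<lambda>t. (t, g ! t)) [0..<length g])) u = ones g u"
proof -
  have "val (rev (map (\<lambda>t. (t, g ! t)) [0..<length g])) u = length (filter (\<lambda>l. odd (u div 2 ^ l)) (map (\<lambda>t. g ! t) [0..<length g]))"
    unfolding val_def rev_filter[symmetric] length_rev by (simp add: filter_map comp_def)
  then show ?thesis by (simp add: map_nth ones_def)
qed

section \<open>Vertices and edges of the constructed graph\<close>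

definition lookup :: "bool list list \<Rightarrow> nat \<Rightarrow> nat \<Rightarrow> bool" where
  "lookup M u v = nth_or False (nth_or [] M u) v"

text \<open>An \<open>assignment\<close> is either a hash function (coordinate number to bit
  position) or a tuple (row to hash value). In an \<open>evertex\<close> the components are the copy
  number, the hash function and the graph of the map f, with entries \<open>(q, a, b)\<close>. A
  \<open>vertex\<close> carries both kinds of data after its tag, dummies filling the component that
  does not apply.\<close>

type_synonym svertex = "nat \<times> nat \<times> nat \<times> nat"
type_synonym assignment = "(nat \<times> nat) list"
type_synonym evertex = "nat \<times> assignment \<times> (assignment \<times> nat \<times> nat) list"
type_synonym vertex = "nat \<times> svertex \<times> evertex"

definition cells :: "nat \<Rightarrow> (nat \<times> nat) list" where
  "cells k = concat (map (\<lambda>a. map (\<lambda>b. (a, b)) [0..<k]) [0..<k])"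

definition svertices :: "nat \<Rightarrow> bool list list \<Rightarrow> svertex list" where
  "svertices k M = filter (\<lambda>s. if fst s = fst (snd s) then fst (snd (snd s)) = snd (snd (snd s))
       else lookup M (fst (snd (snd s))) (snd (snd (snd s))))
     (concat (map (\<lambda>p. concat (map (\<lambda>u. map (\<lambda>v. (fst p, snd p, u, v)) [0..<length M]) [0..<length M])) (cells k)))"

text \<open>Bit positions run from 0 to \<open>L\<close> inclusive: bit \<open>L\<close> of a number
  below \<open>2 ^ L\<close> is zero, so position \<open>L\<close> fills up hash functions that need
  fewer than \<open>r\<close> coordinates. Hash values run from 0 to \<open>r\<close>.\<close>

definition evertices :: "nat \<Rightarrow> nat \<Rightarrow> nat \<Rightarrow> nat \<Rightarrow> nat \<Rightarrow> evertex list" where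
  "evertices N k L r h = concat (map (\<lambda>c. concat (map (\<lambda>i. map (\<lambda>f. (c, i, f))
     (choices N (choices N [0..<k] [0..<Suc r]) (cells k))) (choices N [0..<r] [0..<Suc L]))) [0..<h])"

text \<open>The first component is a tag: 0 for a hub dominating all vertices with tag 1, which are
  pairwise non-adjacent; 1 for pairs; 2 for elements to be covered. The vertex \<open>(k, k, 0, 0)\<close> covers
  nothing and only ensures that there are two vertices. The elements occur in \<open>h\<close> copies, so that fewer
  than \<open>h\<close> vertices always miss a complete copy.\<close>

definition vertices :: "nat \<Rightarrow> bool list list \<Rightarrow> nat \<Rightarrow> nat \<Rightarrow> nat \<Rightarrow> nat \<Rightarrow> vertex list" where
  "vertices k M N L r h = (0, (0, 0, 0, 0), (0, [], [])) # (1, (k, k, 0, 0), (0, [], [])) #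
     map (\<lambda>s. (1, s, (0, [], []))) (svertices k M) @ map (\<lambda>e. (2, (0, 0, 0, 0), e)) (evertices N k L r h)"

text \<open>Bounded quantifiers over lists and projections replace pattern matching, so that the
  polynomial-time rules apply; \<open>covers_iff\<close> is the readable form.\<close>

definition covers :: "svertex \<Rightarrow> evertex \<Rightarrow> bool" where
  "covers s e \<longleftrightarrow> (\<exists>q\<in>set (snd (snd e)). fst (snd q) = fst s \<and> snd (snd q) = fst (snd s) \<and>
     (\<exists>w\<in>set (fst q). fst w = fst s \<and> snd w = val (fst (snd e)) (fst (snd (snd s)))) \<and>
     (\<exists>w\<in>set (fst q). fst w = fst (snd s) \<and> snd w = val (fst (snd e)) (snd (snd (snd s)))))"

lemma covers_iff: "covers (a, b, u, v) (c, i, f) \<longleftrightarrow>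
  (\<exists>q. (q, a, b) \<in> set f \<and> (a, val i u) \<in> set q \<and> (b, val i v) \<in> set q)"
  unfolding covers_def by force

definition adj :: "vertex \<Rightarrow> vertex \<Rightarrow> bool" where
  "adj d d' \<longleftrightarrow> fst d = 0 \<and> fst d' = 1 \<or> fst d = 1 \<and> fst d' = 0 \<or>
     fst d = 1 \<and> fst d' = 2 \<and> covers (fst (snd d)) (snd (snd d')) \<or>
     fst d = 2 \<and> fst d' = 1 \<and> covers (fst (snd d')) (snd (snd d))"

lemma adj_sym: "adj d d' = adj d' d" unfolding adj_def by blast
lemma adj_irrefl: "\<not> adj d d" unfolding adj_def by auto

lemma set_cells: "set (cells k) = {..<k} \<times> {..<k}"
  unfolding cells_def by auto

lemma length_cells: "length (cells k) = k ^ 2"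
  unfolding cells_def by (simp add: length_concat comp_def sum_list_triv power2_eq_square)

lemma in_svertices: "(a, b, u, v) \<in> set (svertices k M) \<longleftrightarrow> a < k \<and> b < k \<and> u < length M \<and> v < length M \<and>
   (if a = b then u = v else lookup M u v)"
  unfolding svertices_def by (auto simp: set_cells image_iff)

lemma in_evertices: "(c, i, f) \<in> set (evertices N k L r h) \<longleftrightarrow> c < h \<and> i \<in> set (choices N [0..<r] [0..<Suc L]) \<and>
   f \<in> set (choices N (choices N [0..<k] [0..<Suc r]) (cells k))"
  unfolding evertices_def set_concat set_map by (auto simp del: upt_Suc simp: image_iff)

section \<open>Graphs on the positions of a list of vertex descriptions\<close>

definition list_graph :: "('a \<Rightarrow> 'a \<Rightarrow> bool) \<Rightarrow> 'a list \<Rightarrow> nat set set" where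
  "list_graph A ds = {{i, j} | i j. i < length ds \<and> j < length ds \<and> A (ds ! i) (ds ! j)}"

lemma list_graph_iff:
  assumes "\<And>d d'. A d d' = A d' d" "i < length ds" "j < length ds"
  shows "{i, j} \<in> list_graph A ds \<longleftrightarrow> A (ds ! i) (ds ! j)"
  unfolding list_graph_def using assms by (auto simp: doubleton_eq_iff)

lemma graph_list_graph:
  assumes "\<And>d. \<not> A d d" shows "graph (length ds) (list_graph A ds)"
  unfolding graph_def list_graph_def
proof safe
  fix i j assume ij: "i < length ds" "j < length ds" "A (ds ! i) (ds ! j)"
  then have "i \<noteq> j" using assms by metis
  then show "card {i, j} = 2" by simp
qed

lemma enc_list_graph:
  assumes "\<And>d d'. A d d' = A d' d"
  shows "enc_graph (length ds) (list_graph A ds) = enc (map (\<lambda>d. map (A d) ds) ds)"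
proof -
  have "map (\<lambda>d. map (A d) ds) ds = map (\<lambda>i. map (\<lambda>j. {i, j} \<in> list_graph A ds) [0..<length ds]) [0..<length ds]"
    by (intro nth_equalityI) (simp_all add: list_graph_iff[OF assms])
  then show ?thesis by (simp add: enc_graph_def enc_list_def enc_bool_def comp_def)
qed

definition matrix :: "nat \<Rightarrow> nat set set \<Rightarrow> bool list list" where
  "matrix n E = map (\<lambda>u. map (\<lambda>v. {u, v} \<in> E) [0..<n]) [0..<n]"

lemma lookup_matrix: "lookup (matrix n E) u v \<longleftrightarrow> u < n \<and> v < n \<and> {u, v} \<in> E"
  by (auto simp: lookup_def matrix_def nth_or_def)

lemma length_matrix [simp]: "length (matrix n E) = n"
  by (simp add: matrix_def)

lemma enc_matrix: "enc (matrix n E) = enc_graph n E"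
  by (simp add: matrix_def enc_graph_def enc_list_def enc_bool_def comp_def)

text \<open>For an element \<open>(c, i, f)\<close>, the hash values of the clique vertices form a
  tuple; \<open>f\<close> sends it to some cell, and the clique pair of that cell covers the
  element. The assumption \<open>cap\<close> ensures that this tuple is among the enumerated
  ones.\<close>

lemma reduction_complete:
  fixes k m N L r h :: nat
  assumes M: "M = matrix m E" and S: "clique m E S" "card S = k"
    and cap: "Suc r ^ k \<le> N"
  defines "ds \<equiv> vertices k M N L r h"
  shows "\<exists>D. dominating_set (length ds) (list_graph adj ds) D \<and> card D \<le> k ^ 2 + 1"
proof -
  have "finite S" using S(1) finite_subset unfolding clique_def by blast
  then obtain v where v: "bij_betw v {..<k} S" using S(2) by (metis ex_bij_betw_nat_finite lessThan_atLeast0)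
  have vm: "v a < m" if "a < k" for a using v S(1) that unfolding clique_def bij_betw_def by auto
  have ve: "{v a, v b} \<in> E" if "a < k" "b < k" "a \<noteq> b" for a b
    using v S(1) that unfolding clique_def bij_betw_def inj_on_def by blast
  define sv :: "nat \<times> nat \<Rightarrow> vertex" where
    "sv p = (1, (fst p, snd p, v (fst p), v (snd p)), (0, [], []))" for p
  have s: "sv p \<in> set ds" if "p \<in> {..<k} \<times> {..<k}" for p
  proof -
    obtain a b where p: "p = (a, b)" by (cases p)
    have "(a, b, v a, v b) \<in> set (svertices k M)" using that vm ve by (auto simp: p in_svertices M lookup_matrix)
    then show ?thesis by (auto simp: p ds_def vertices_def sv_def)
  qed
  then have "\<forall>p\<in>{..<k} \<times> {..<k}. \<exists>j<length ds. ds ! j = sv p" unfolding in_set_conv_nth by blast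
  then have "\<exists>idx. \<forall>p\<in>{..<k} \<times> {..<k}. idx p < length ds \<and> ds ! idx p = sv p" by (rule bchoice)
  then obtain idx where "\<forall>p\<in>{..<k} \<times> {..<k}. idx p < length ds \<and> ds ! idx p = sv p" by (rule exE)
  note idx = bspec[OF this]
  \<comment> \<open>Position 0 is the hub: it dominates all pairs, including those outside the
    clique, and costs the additional 1.\<close>
  let ?D = "insert 0 (idx ` ({..<k} \<times> {..<k}))"
  have ds0: "ds ! 0 = (0, (0, 0, 0, 0), (0, [], []))" "0 < length ds" by (simp_all add: ds_def vertices_def)
  have "\<exists>u\<in>?D. {u, j} \<in> list_graph adj ds" if j: "j < length ds" "j \<noteq> 0" for j
  proof -
    have "ds ! j \<in> set (tl ds)" using j by (cases ds) (auto simp: nth_Cons split: nat.split)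
    then consider (s) s where "ds ! j = (1, s, (0, [], []))" | (e) c i f where "ds ! j = (2, (0, 0, 0, 0), (c, i, f))"
        "(c, i, f) \<in> set (evertices N k L r h)"
      unfolding ds_def vertices_def by fastforce
    then show ?thesis
    proof cases
      case s
      then have "{0, j} \<in> list_graph adj ds" using j ds0 by (subst list_graph_iff[OF adj_sym]) (auto simp: adj_def)
      then show ?thesis by blast
    next
      case e
      then have i: "i \<in> set (choices N [0..<r] [0..<Suc L])"
        and f: "f \<in> set (choices N (choices N [0..<k] [0..<Suc r]) (cells k))" by (auto simp: in_evertices)
      let ?q = "rev (map (\<lambda>a. (a, val i (v a))) [0..<k])"
      have vr: "val i u \<le> r" for u using choices_length[OF i] length_filter_le[of _ i] unfolding val_def by simp
      have "?q \<in> set (choices N [0..<k] [0..<Suc r])"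
      proof (rule choices_complete)
        show "val i (v a) \<in> set [0..<Suc r]" for a unfolding set_upt using vr[of "v a"] by simp
      qed (use cap in simp)
      from choices_total[OF f this] obtain a b where ab: "a < k" "b < k" "(?q, a, b) \<in> set f" by (auto simp: set_cells)
      then have "covers (a, b, v a, v b) (c, i, f)" unfolding covers_iff by (intro exI[of _ ?q]) auto
      then have "{idx (a, b), j} \<in> list_graph adj ds" using j e idx[of "(a, b)"] ab
        by (subst list_graph_iff[OF adj_sym]) (auto simp: adj_def sv_def)
      then show ?thesis using ab by blast
    qed
  qed
  then have "dominating_set (length ds) (list_graph adj ds) ?D"
    unfolding dominating_set_def using idx ds0 by auto
  moreover have "card ?D \<le> k ^ 2 + 1"
  proof -
    have "card (idx ` ({..<k} \<times> {..<k})) \<le> k ^ 2"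
      using card_image_le[of "{..<k} \<times> {..<k}" idx] by (simp add: card_cartesian_product power2_eq_square)
    then show ?thesis using card_insert_le_m1[of "k ^ 2 + 1" "idx ` ({..<k} \<times> {..<k})" 0] by simp
  qed
  ultimately show ?thesis by blast
qed

text \<open>The two bounds in \<open>cap\<close> guarantee that the hash function and the map f
  constructed in the argument occur among the elements. The size of \<open>r\<close> is
  \<open>(2 * h) ^ 3\<close>: fewer than \<open>h\<close> pairs mention fewer than
  \<open>2 * h\<close> vertices, and \<open>ones_inj\<close> needs their cube.\<close>

lemma reduction_sound:
  fixes k m N L r h :: nat
  assumes M: "M = matrix m E" and G: "graph m E"
    and cap: "Suc L ^ r \<le> N" "(k ^ 2) ^ (Suc r ^ k) \<le> N"
    and m: "m < 2 ^ L" and r: "r = 8 * h ^ 3"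
  defines "ds \<equiv> vertices k M N L r h"
  assumes D: "dominating_set (length ds) (list_graph adj ds) D" "card D < h"
  shows "\<exists>S. clique m E S \<and> card S = k"
proof (cases "k = 0")
  case True then show ?thesis by (intro exI[of _ "{}"]) (simp add: clique_def)
next
  case False
  have Dsub: "D \<subseteq> {..<length ds}" using D unfolding dominating_set_def by blast
  then have fin: "finite D" by (rule finite_subset) simp
  let ?u = "\<lambda>j. fst (snd (snd (fst (snd (ds ! j)))))"
  let ?v = "\<lambda>j. snd (snd (snd (fst (snd (ds ! j)))))"
  let ?Y = "?u ` D \<union> ?v ` D"
  have "card ?Y \<le> card (?u ` D) + card (?v ` D)" by (rule card_Un_le)
  also have "\<dots> \<le> card D + card D" using fin by (intro add_mono card_image_le)
  finally have cY: "card ?Y \<le> 2 * h" using D(2) by simp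
  have ltL: "?u j < 2 ^ L" "?v j < 2 ^ L" if "j \<in> D" for j
  proof -
    have "ds ! j \<in> set ds" using that Dsub by auto
    \<comment> \<open>The set \<open>D\<close> may contain the hub, the isolated pair or elements;
      their dummy entries are 0 and thus also below \<open>2 ^ L\<close>.\<close>
    then have "(?u j = 0 \<and> ?v j = 0) \<or> fst (snd (ds ! j)) \<in> set (svertices k M)"
      unfolding ds_def vertices_def by auto
    then have "(?u j = 0 \<and> ?v j = 0) \<or> (?u j < m \<and> ?v j < m)"
      using in_svertices[of "fst (fst (snd (ds ! j)))" "fst (snd (fst (snd (ds ! j))))" "?u j" "?v j" k M] by (auto simp: M)
    then show "?u j < 2 ^ L" "?v j < 2 ^ L" using m by auto
  qed
  obtain g0 where g0: "set g0 \<subseteq> {..<L}" "length g0 \<le> card ?Y ^ 3" "inj_on (ones g0) ?Y"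
    using ones_inj[of ?Y L] fin ltL by blast
  have "card ?Y ^ 3 \<le> (2 * h) ^ 3" using cY by (intro power_mono) auto
  then have lg: "length g0 \<le> r" using g0(2) unfolding r by (simp add: power_mult_distrib)
  \<comment> \<open>Position \<open>L\<close> contributes nothing to the count on \<open>?Y\<close>
    and brings the length to exactly \<open>r\<close>.\<close>
  define g where "g = g0 @ replicate (r - length g0) L"
  have g: "length g = r" "set g \<subseteq> {..<Suc L}" using lg g0 by (auto simp: g_def)
  have "ones g y = ones g0 y" if "y \<in> ?Y" for y
  proof -
    have "y < 2 ^ L" using that ltL by blast
    then show ?thesis by (auto simp: g_def ones_def)
  qed
  then have inj: "inj_on (ones g) ?Y" using g0(3) inj_on_cong by blast
  define i where "i = rev (map (\<lambda>t. (t, g ! t)) [0..<r])"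
  have val: "val i u = ones g u" for u unfolding i_def g(1)[symmetric] by (rule val_ones)
  have i: "i \<in> set (choices N [0..<r] [0..<Suc L])" unfolding i_def
  proof (rule choices_complete)
    fix t assume "t \<in> set [0..<r]"
    then have "g ! t \<in> set g" using g(1) by simp
    then show "g ! t \<in> set [0..<Suc L]" using g(2) by auto
  qed (use cap in simp)
  have "card ((\<lambda>j. fst (snd (snd (ds ! j)))) ` D) < h" using card_image_le[OF fin] D(2) by (rule le_less_trans)
  \<comment> \<open>A copy \<open>c\<close> avoided by \<open>D\<close> ensures that the undominated
    element built below does not itself belong to \<open>D\<close>.\<close>
  then have "\<not> {..<h} \<subseteq> (\<lambda>j. fst (snd (snd (ds ! j)))) ` D" using fin
    by (metis card_lessThan card_mono finite_imageI leD)
  then obtain c where c: "c < h" "\<And>j. j \<in> D \<Longrightarrow> fst (snd (snd (ds ! j))) \<noteq> c" by auto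
  let ?A = "choices N [0..<k] [0..<Suc r]"
  let ?P = "\<lambda>q p. \<exists>j\<in>D. \<exists>u v. ds ! j = (1, (fst p, snd p, u, v), (0, [], [])) \<and> (fst p, val i u) \<in> set q \<and> (snd p, val i v) \<in> set q"
  have "\<exists>q\<in>set ?A. \<forall>p\<in>set (cells k). ?P q p"
  proof (rule ccontr)
    assume "\<not> ?thesis"
    then have "\<forall>q\<in>set ?A. \<exists>p\<in>set (cells k). \<not> ?P q p" by blast
    then obtain \<beta> where \<beta>: "\<And>q. q \<in> set ?A \<Longrightarrow> \<beta> q \<in> set (cells k) \<and> \<not> ?P q (\<beta> q)" by metis
    define f where "f = rev (map (\<lambda>q. (q, \<beta> q)) ?A)"
    have "length ?A \<le> Suc r ^ k" using length_choices_le[of N "[0..<k]" "[0..<Suc r]"] by (simp only: length_upt diff_zero)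
    then have "(k ^ 2) ^ length ?A \<le> (k ^ 2) ^ (Suc r ^ k)" using False by (intro power_increasing) auto
    then have f: "f \<in> set (choices N ?A (cells k))"
      unfolding f_def using cap \<beta> by (intro choices_complete) (auto simp: length_cells)
    define e :: vertex where "e = (2, (0, 0, 0, 0), (c, i, f))"
    have "(c, i, f) \<in> set (evertices N k L r h)" using c i f by (simp only: in_evertices)
    then have "e \<in> set ds" unfolding ds_def vertices_def e_def by simp
    then obtain j where j: "j < length ds" "ds ! j = e" unfolding in_set_conv_nth by blast
    have "j \<notin> D" using c(2)[of j] j by (auto simp: e_def)
    then obtain j' where j': "j' \<in> D" "{j', j} \<in> list_graph adj ds"
      using D(1) j(1) unfolding dominating_set_def by auto
    then have a: "adj (ds ! j') e" using list_graph_iff[where A = adj and ds = ds, OF adj_sym, of j' j] j Dsub by auto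
    then have 1: "fst (ds ! j') = 1" "covers (fst (snd (ds ! j'))) (c, i, f)" by (auto simp: adj_def e_def)
    have "ds ! j' \<in> set ds" using j'(1) Dsub by auto
    with 1 obtain a b u v where d: "ds ! j' = (1, (a, b, u, v), (0, [], []))" unfolding ds_def vertices_def by auto
    with 1 obtain q where "(q, a, b) \<in> set f" "(a, val i u) \<in> set q" "(b, val i v) \<in> set q" by (auto simp: covers_iff)
    then have "q \<in> set ?A" "\<beta> q = (a, b)" "(a, val i u) \<in> set q" "(b, val i v) \<in> set q" by (auto simp: f_def)
    with \<beta>[of q] j' d show False by fastforce
  qed
  then obtain q where q: "q \<in> set ?A" "\<And>p. p \<in> set (cells k) \<Longrightarrow> ?P q p" by blast
  \<comment> \<open>As \<open>q\<close> is a function on the rows, each row \<open>a\<close> has one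
    hash value, and injectivity on \<open>?Y\<close> turns it into one vertex.\<close>
  have dist: "distinct (map fst q)" using choices_map_fst[OF q(1)] by simp
  have key: "x = y" if "(a, x) \<in> set q" "(a, y) \<in> set q" for a x y
    using dist that by (rule eq_key_imp_eq_value)
  have P: "\<exists>u v. u \<in> ?Y \<and> v \<in> ?Y \<and> (a, b, u, v) \<in> set (svertices k M) \<and> (a, val i u) \<in> set q \<and> (b, val i v) \<in> set q"
    if ab: "a < k" "b < k" for a b
  proof -
    obtain j u v where j: "j \<in> D" "ds ! j = (1, (a, b, u, v), (0, [], []))" "(a, val i u) \<in> set q" "(b, val i v) \<in> set q"
      using q(2)[of "(a, b)"] ab by (auto simp: set_cells)
    have "ds ! j \<in> set ds" using j(1) Dsub by auto
    then have "(a, b, u, v) \<in> set (svertices k M)" using j(2) ab unfolding ds_def vertices_def by auto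
    moreover have "u \<in> ?u ` D" "v \<in> ?v ` D" using j by force+
    ultimately show ?thesis using j by blast
  qed
  \<comment> \<open>The diagonal cell \<open>(a, a)\<close> already supplies such a vertex, also
    when \<open>k = 1\<close>.\<close>
  have "\<forall>a<k. \<exists>u. u \<in> ?Y \<and> u < m \<and> (a, val i u) \<in> set q" using P by (fastforce simp: in_svertices M)
  then obtain w where w: "\<And>a. a < k \<Longrightarrow> w a \<in> ?Y \<and> w a < m \<and> (a, val i (w a)) \<in> set q" by metis
  have uniq: "u = w a" if "a < k" "u \<in> ?Y" "(a, val i u) \<in> set q" for a u
  proof -
    have "val i u = val i (w a)" by (rule key[OF that(3)]) (use w[OF that(1)] in simp)
    then show ?thesis unfolding val by (rule inj_onD[OF inj _ that(2)]) (use w[OF that(1)] in simp)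
  qed
  have edge: "{w a, w b} \<in> E" if ab: "a < k" "b < k" "a \<noteq> b" for a b
  proof -
    obtain u v where uv: "u \<in> ?Y" "v \<in> ?Y" "(a, b, u, v) \<in> set (svertices k M)" "(a, val i u) \<in> set q" "(b, val i v) \<in> set q"
      using P[OF ab(1,2)] by blast
    then have "u = w a" "v = w b" using uniq ab by blast+
    then show ?thesis using uv(3) ab(3) by (simp add: in_svertices M lookup_matrix)
  qed
  \<comment> \<open>Edges are two-element sets, so adjacent vertices are distinct and the clique has
    full size \<open>k\<close>.\<close>
  have "w a \<noteq> w b" if "a < k" "b < k" "a \<noteq> b" for a b
    using edge[OF that] G unfolding graph_def by fastforce
  then have injw: "inj_on w {..<k}" by (auto simp: inj_on_def)
  have "clique m E (w ` {..<k})" unfolding clique_def using w edge by auto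
  moreover have "card (w ` {..<k}) = k" using card_image[OF injw] by simp
  ultimately show ?thesis by blast
qed


section \<open>Running time and parameters\<close>

lemmas PH_intros = PH_id PH_const PH_fst PH_snd PH_Pair PH_Cons PH_If PH_map PH_append PH_concat PH_filter PH_Not PH_conj PH_disj
  PH_Bex PH_Ball PH_length PH_Suc PH_add PH_mult PH_power PH_le PH_less PH_eq PH_upt PH_nth_or PH_div_pow2 PH_odd PH_cap_pow
  PH_choices

text \<open>The function is treated on a plain pair and then composed with its arguments, because
  under \<open>filter\<close> or \<open>map\<close> the environment itself becomes a pair and the
  assumptions on the arguments would no longer match.\<close>

lemma PH_val: assumes "PH i" "PH u" shows "PH (\<lambda>x. val (i x) (u x))"
proof -
  have "PH (\<lambda>p. val (fst p) (snd p))" unfolding val_def by (intro PH_intros)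
  from PH_compose[OF this PH_Pair[OF assms]] show ?thesis by simp
qed

lemma PH_lookup: assumes "PH M" "PH u" "PH v" shows "PH (\<lambda>x. lookup (M x) (u x) (v x))"
  unfolding lookup_def by (intro PH_intros assms)

lemma PH_cells: assumes "PH k" shows "PH (\<lambda>x. cells (k x))"
proof -
  have "PH cells" unfolding cells_def[abs_def] by (intro PH_intros)
  from PH_compose[OF this assms] show ?thesis .
qed

lemma PH_svertices: assumes "PH k" "PH M" shows "PH (\<lambda>x. svertices (k x) (M x))"
proof -
  have "PH (\<lambda>p. svertices (fst p) (snd p))" unfolding svertices_def by (intro PH_intros PH_lookup PH_cells)
  from PH_compose[OF this PH_Pair[OF assms]] show ?thesis by simp
qed

lemma PH_evertices:
  assumes "PH N" "PH k" "PH L" "PH r" "PH h" shows "PH (\<lambda>x. evertices (N x) (k x) (L x) (r x) (h x))"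
proof -
  have "PH (\<lambda>p. evertices (fst p) (fst (snd p)) (fst (snd (snd p))) (fst (snd (snd (snd p)))) (snd (snd (snd (snd p)))))"
    unfolding evertices_def by (intro PH_intros PH_cells)
  from PH_compose[OF this PH_Pair[OF assms(1) PH_Pair[OF assms(2) PH_Pair[OF assms(3) PH_Pair[OF assms(4,5)]]]]]
  show ?thesis by simp
qed

lemma PH_vertices:
  assumes "PH k" "PH M" "PH N" "PH L" "PH r" "PH h"
  shows "PH (\<lambda>x. vertices (k x) (M x) (N x) (L x) (r x) (h x))"
  unfolding vertices_def by (intro PH_intros PH_svertices PH_evertices assms)

lemma PH_covers: assumes "PH s" "PH e" shows "PH (\<lambda>x. covers (s x) (e x))"
proof -
  have "PH (\<lambda>p. covers (fst p) (snd p))" unfolding covers_def by (intro PH_intros PH_val)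
  from PH_compose[OF this PH_Pair[OF assms]] show ?thesis by simp
qed

lemma PH_adj: assumes "PH d" "PH d'" shows "PH (\<lambda>x. adj (d x) (d' x))"
  unfolding adj_def by (intro PH_intros PH_covers assms)

section \<open>The parameters of the reduction\<close>

definition nbits :: "nat \<Rightarrow> nat" where
  "nbits N = length (filter (\<lambda>i. \<not> N div 2 ^ i = 0) [0..<N])"

lemma PH_nbits: assumes "PH N" shows "PH (\<lambda>x. nbits (N x))"
proof -
  have "PH nbits" unfolding nbits_def[abs_def] by (intro PH_intros)
  from PH_compose[OF this assms] show ?thesis .
qed

text \<open>The parameter of the dominating set instance: \<open>k ^ 2\<close> pairs and the
  hub.\<close>

definition budget :: "nat \<Rightarrow> nat" where "budget k = k ^ 2 + 1"
text \<open>The size estimates use powers of \<open>h\<close> up to \<open>h ^ 5\<close> and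
  \<open>h ^ (4 * k + 2)\<close>. As \<open>k\<close> is at most \<open>budget k\<close>, this
  linear expression in the budget covers both; it is linear in the budget because the final exponent
  has to be a polynomial in the new parameter.\<close>

definition expo :: "nat \<Rightarrow> nat" where "expo k = 6 * budget k + 8"
text \<open>The term \<open>8 * budget k ^ 2\<close> is what \<open>gap\<close> requires; the
  remainder \<open>48 * budget k + 65\<close> equals \<open>8 * expo k + 1\<close> and absorbs the
  constants in the count of hash functions.\<close>

definition hmin :: "nat \<Rightarrow> nat" where "hmin k = 8 * budget k ^ 2 + 48 * budget k + 65"
text \<open>Doubly exponential, so that the binary length of \<open>N\<close> exceeds
  \<open>2 ^ (hmin k * expo k)\<close>, hence also \<open>hmin k ^ expo k\<close>.\<close>

definition pad :: "nat \<Rightarrow> nat" where "pad k = 2 ^ (2 ^ (hmin k * expo k))"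

lemma PH_budget: "PH k \<Longrightarrow> PH (\<lambda>x. budget (k x))"
  unfolding budget_def by (intro PH_intros)

lemma PH_expo: "PH k \<Longrightarrow> PH (\<lambda>x. expo (k x))"
  unfolding expo_def by (intro PH_intros PH_budget)

lemma PH_hmin: "PH k \<Longrightarrow> PH (\<lambda>x. hmin (k x))"
  unfolding hmin_def by (intro PH_intros PH_budget)

text \<open>The integer part of the root of \<open>L\<close> of order \<open>expo k\<close>, written
  as a bounded count just as \<open>nbits\<close> is for the binary length. The power is capped at
  \<open>L + 1\<close>, which suffices for the comparison with \<open>L\<close>.\<close>

definition hsize :: "nat \<Rightarrow> nat \<Rightarrow> nat" where
  "hsize k L = length (filter (\<lambda>x. cap_pow (Suc L) (Suc x) (expo k) \<le> L) [0..<L])"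

lemma PH_hsize: assumes "PH k" "PH L" shows "PH (\<lambda>x. hsize (k x) (L x))"
proof -
  have "PH (\<lambda>p. hsize (fst p) (snd p))" unfolding hsize_def by (intro PH_intros PH_expo)
  from PH_compose[OF this PH_Pair[OF assms]] show ?thesis by simp
qed

text \<open>The input is paired with a padding term, the unary number that makes \<open>N\<close> large compared with \<open>k\<close>.\<close>

type_synonym input = "(nat \<times> bool list list) \<times> nat"

definition in_N :: "input \<Rightarrow> nat" where "in_N y = snd y + length (snd (fst y))"
definition in_h :: "input \<Rightarrow> nat" where "in_h y = hsize (fst (fst y)) (nbits (in_N y))"
definition in_verts :: "input \<Rightarrow> vertex list" where
  "in_verts y = vertices (fst (fst y)) (snd (fst y)) (in_N y) (nbits (in_N y)) (8 * in_h y ^ 3) (in_h y)"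
definition inst :: "input \<Rightarrow> nat \<times> bool list list" where
  "inst y = (budget (fst (fst y)), map (\<lambda>d. map (\<lambda>d'. adj d d') (in_verts y)) (in_verts y))"

lemma PH_in_N: "PH f \<Longrightarrow> PH (\<lambda>x. in_N (f x))" unfolding in_N_def by (intro PH_intros)
lemma PH_in_h: "PH f \<Longrightarrow> PH (\<lambda>x. in_h (f x))" unfolding in_h_def by (intro PH_intros PH_hsize PH_nbits PH_in_N)
lemma PH_in_verts: "PH f \<Longrightarrow> PH (\<lambda>x. in_verts (f x))"
  unfolding in_verts_def by (intro PH_vertices PH_intros PH_nbits PH_in_N PH_in_h)
lemma PH_inst: "PH inst"
  unfolding inst_def[abs_def] by (intro PH_intros PH_budget PH_adj PH_in_verts)

section \<open>Decoding and verifying a proposed dominating set\<close>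

fun spine :: "dtree \<Rightarrow> dtree list" where
  "spine Leaf = []"
| "spine (Node a b) = a # spine b"

lemma enc_spine: "enc (spine d) = enc d"
  by (induction d rule: spine.induct) (simp_all add: enc_dtree_def)

lemma PH_spine: "PH f \<Longrightarrow> PH (\<lambda>x. spine (f x))"
  by (rule PH_recode[OF enc_spine])

lemma spine_enc_list: "spine (enc_list xs) = xs"
  by (induction xs) auto

lemma length_spine_enc_nat: "length (spine (Defs.enc_nat n)) = n"
  by (simp add: Defs.enc_nat_def spine_enc_list)

text \<open>Every tree is a list of trees along its right spine, and the length of such a list is a
  number. Thus any output decodes to some list of numbers, whether or not it is a proper
  encoding.\<close>

definition out_list :: "dtree \<Rightarrow> nat list" where
  "out_list d = map (\<lambda>e. length (spine e)) (spine d)"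

lemma PH_out_list: "PH f \<Longrightarrow> PH (\<lambda>x. out_list (f x))"
  unfolding out_list_def by (intro PH_intros PH_spine)

lemma set_out_list: "encodes_vertex_set d S \<Longrightarrow> set (out_list d) = S"
  unfolding encodes_vertex_set_def out_list_def by (auto simp: spine_enc_list length_spine_enc_nat image_image)

text \<open>Size is counted over the actual vertices, so that repetitions and entries out of range
  in the output do not matter. The threshold \<open>in_h\<close> is the one below which domination
  forces a clique.\<close>

definition check :: "input \<times> dtree \<Rightarrow> bool" where
  "check w \<longleftrightarrow> (\<forall>v\<in>set [0..<length (in_verts (fst w))]. \<exists>u\<in>set (out_list (snd w)). u = v \<or> lookup (snd (inst (fst w))) u v) \<and>
     length (filter (\<lambda>v. \<exists>u\<in>set (out_list (snd w)). u = v) [0..<length (in_verts (fst w))]) < in_h (fst w)"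

lemma PH_check: "PH check"
  unfolding check_def[abs_def]
  by (intro PH_intros PH_in_verts PH_out_list PH_lookup PH_in_h PH_compose[OF PH_inst])

lemma snd_inst: "snd (inst y) = matrix (length (in_verts y)) (list_graph adj (in_verts y))"
  unfolding inst_def matrix_def
  by (simp, intro nth_equalityI) (simp_all add: list_graph_iff[OF adj_sym])

text \<open>An entry out of range equals no vertex, and its lookup in the matrix is false; hence the
  verification sees exactly the part of the output within the vertex set.\<close>

lemma check_iff: "check (y, d) \<longleftrightarrow> (\<exists>D. D = set (out_list d) \<inter> {..<length (in_verts y)} \<and>
  dominating_set (length (in_verts y)) (list_graph adj (in_verts y)) D \<and> card D < in_h y)"
proof -
  let ?n = "length (in_verts y)" and ?E = "list_graph adj (in_verts y)"
  let ?D = "set (out_list d) \<inter> {..<?n}"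
  have "length (filter (\<lambda>v. \<exists>u\<in>set (out_list d). u = v) [0..<?n]) = card (set (filter (\<lambda>v. \<exists>u\<in>set (out_list d). u = v) [0..<?n]))"
    by (rule distinct_card[symmetric]) simp
  also have "set (filter (\<lambda>v. \<exists>u\<in>set (out_list d). u = v) [0..<?n]) = ?D" by auto
  finally have 1: "length (filter (\<lambda>v. \<exists>u\<in>set (out_list d). u = v) [0..<?n]) = card ?D" .
  have "(\<forall>v\<in>set [0..<?n]. \<exists>u\<in>set (out_list d). u = v \<or> lookup (snd (inst y)) u v) \<longleftrightarrow> dominating_set ?n ?E ?D"
    unfolding dominating_set_def snd_inst lookup_matrix by auto
  then show ?thesis unfolding check_def fst_conv snd_conv 1 by simp
qed


section \<open>Bounds on the parameters\<close>

lemma nbits: assumes "0 < N" shows "N < 2 ^ nbits N" "2 ^ nbits N \<le> 2 * N"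
proof -
  define L where "L = (LEAST L. N < 2 ^ L)"
  have L: "N < 2 ^ L" unfolding L_def by (rule LeastI[of _ N]) (rule less_exp)
  have lt: "i < L \<longleftrightarrow> 2 ^ i \<le> N" for i
  proof
    assume "i < L" then show "2 ^ i \<le> N" using not_less_Least[of i "\<lambda>L. N < 2 ^ L"] by (simp add: L_def)
  next
    assume i: "2 ^ i \<le> N"
    show "i < L"
    proof (rule ccontr)
      assume "\<not> i < L"
      then have "(2::nat) ^ L \<le> 2 ^ i" by (simp add: power_increasing)
      then show False using i L by linarith
    qed
  qed
  have "0 < L" using lt[of 0] assms by simp
  then have 2: "2 ^ (L - 1) \<le> N" using lt[of "L - 1"] by simp
  have "L - 1 < 2 ^ (L - 1)" by (rule less_exp)
  with 2 have "L \<le> N" by linarith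
  have "(\<not> N div 2 ^ i = 0) \<longleftrightarrow> i < L" for i unfolding lt by (simp add: div_eq_0_iff not_less)
  then have "nbits N = L" using \<open>L \<le> N\<close> by (simp add: nbits_def length_filter_less_upt)
  then show "N < 2 ^ nbits N" "2 ^ nbits N \<le> 2 * N" using L 2 \<open>0 < L\<close>
    by (simp_all add: power_eq_if[of 2 L])
qed

lemma hsize: shows "hsize k L ^ expo k \<le> L" "L < Suc (hsize k L) ^ expo k"
    and "x ^ expo k \<le> L \<Longrightarrow> x \<le> hsize k L"
proof -
  let ?K = "expo k"
  have K: "0 < ?K" by (simp add: expo_def)
  define h where "h = (LEAST h. L < Suc h ^ ?K)"
  have "L < Suc L ^ ?K" by (rule less_le_trans[OF _ self_le_power]) (use K in auto)
  then have h: "L < Suc h ^ ?K" unfolding h_def by (rule LeastI)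
  have lt: "i < h \<longleftrightarrow> Suc i ^ ?K \<le> L" for i
  proof
    assume "i < h" then show "Suc i ^ ?K \<le> L" using not_less_Least[of i "\<lambda>h. L < Suc h ^ ?K"] by (simp add: h_def)
  next
    assume i: "Suc i ^ ?K \<le> L"
    show "i < h"
    proof (rule ccontr)
      assume "\<not> i < h"
      then have "Suc h ^ ?K \<le> Suc i ^ ?K" by (intro power_mono) auto
      then show False using i h by simp
    qed
  qed
  have hK: "h ^ ?K \<le> L" using lt[of "h - 1"] K by (cases h) (auto simp: power_0_left)
  have "h \<le> h ^ ?K" using K by (cases "h = 0") (auto intro!: self_le_power)
  then have "h \<le> L" using hK by simp
  have "cap_pow (Suc L) (Suc i) ?K \<le> L \<longleftrightarrow> i < h" for i unfolding lt cap_pow by linarith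
  then have e: "hsize k L = h" using \<open>h \<le> L\<close> by (simp add: hsize_def length_filter_less_upt)
  show "hsize k L ^ expo k \<le> L" "L < Suc (hsize k L) ^ expo k" using hK h by (simp_all add: e)
  show "x \<le> hsize k L" if "x ^ expo k \<le> L" using lt[of "x - 1"] that by (cases x) (auto simp: e)
qed

text \<open>The padding forces \<open>h\<close> above \<open>hmin k\<close>, after which constants
  and factors depending on \<open>k\<close> are absorbed into powers of \<open>h\<close>. Each count
  is thus bounded by \<open>2 ^ y\<close> with \<open>y < L\<close>, because \<open>h ^ a\<close> is
  at most \<open>L\<close> for all exponents \<open>a\<close> up to \<open>expo k\<close>.\<close>

lemma parameters:
  fixes k m :: nat
  defines "N \<equiv> pad k + m" defines "L \<equiv> nbits N" defines "h \<equiv> hsize k L" defines "r \<equiv> 8 * h ^ 3"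
  shows "hmin k \<le> h" and "m < 2 ^ L" and "Suc L ^ r \<le> N" and "(k ^ 2) ^ (Suc r ^ k) \<le> N" and "Suc r ^ k \<le> N"
    and "k ^ 2 \<le> N" and "h \<le> N" and "4 \<le> N" and "N < 2 ^ L" and "L < Suc h ^ expo k"
proof -
  have N0: "0 < N" by (simp add: N_def pad_def)
  have L: "N < 2 ^ L" "2 ^ L \<le> 2 * N" using nbits[OF N0] by (simp_all add: L_def)
  have "2 ^ (2 ^ (hmin k * expo k)) < (2::nat) ^ L" using L(1) unfolding N_def pad_def by linarith
  then have L2: "2 ^ (hmin k * expo k) < L" by (rule power_less_imp_less_exp[rotated]) simp
  have "hmin k ^ expo k \<le> (2 ^ hmin k) ^ expo k" by (intro power_mono) (auto intro: less_imp_le less_exp)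
  then have "hmin k ^ expo k \<le> L" using L2 by (simp add: power_mult)
  then show hmin: "hmin k \<le> h" unfolding h_def by (rule hsize(3))
  show LK: "L < Suc h ^ expo k" unfolding h_def by (rule hsize(2))
  have hK: "h ^ expo k \<le> L" unfolding h_def by (rule hsize(1))
  let ?b = "budget k"
  have kb: "k \<le> ?b" by (cases k) (auto simp: budget_def power2_eq_square)
  have h1: "8 * expo k + 1 \<le> h" "9 \<le> h" "2 * k \<le> h" using hmin kb by (auto simp: hmin_def expo_def)
  have pw: "h ^ a \<le> L" if "a \<le> expo k" for a
    by (rule order_trans[OF power_increasing[OF that] hK]) (use h1 in simp)
  \<comment> \<open>From \<open>2 ^ L <= 2 * N\<close> only half of \<open>2 ^ L\<close> is
    available, hence the successor.\<close>
  have le: "x \<le> N" if "Suc y \<le> L" "x \<le> 2 ^ y" for x y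
  proof -
    have "(2::nat) ^ Suc y \<le> 2 ^ L" using that by (intro power_increasing) auto
    then show ?thesis using L(2) that(2) by simp
  qed
  show "N < 2 ^ L" "m < 2 ^ L" using L by (simp_all add: N_def)
  show "Suc L ^ r \<le> N"
  proof (rule le)
    \<comment> \<open>Bounding \<open>L + 1\<close> by \<open>2 ^ (h * expo k)\<close> and inserting
      \<open>r = 8 * h ^ 3\<close> gives the exponent \<open>8 * expo k * h ^ 4\<close>; the factor
      in front is less than \<open>h\<close>, so it stays below \<open>h ^ 5\<close>.\<close>
    have "Suc L ^ r \<le> (Suc h ^ expo k) ^ r" using LK by (intro power_mono) auto
    also have "\<dots> \<le> ((2 ^ h) ^ expo k) ^ r"
      by (intro power_mono) (use less_exp[of h] in \<open>auto simp: Suc_le_eq\<close>)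
    also have "\<dots> = 2 ^ (8 * expo k * h ^ 4)"
      by (simp add: power_mult[symmetric] r_def mult.commute mult.left_commute power4_eq_xxxx power3_eq_cube)
    finally show "Suc L ^ r \<le> 2 ^ (8 * expo k * h ^ 4)" .
    have "Suc (8 * expo k * h ^ 4) \<le> (8 * expo k + 1) * h ^ 4" using h1 by (simp add: Suc_le_eq)
    also have "\<dots> \<le> h * h ^ 4" using h1 by (intro mult_right_mono) auto
    also have "\<dots> = h ^ 5" by (simp add: eval_nat_numeral)
    also have "\<dots> \<le> L" by (rule pw) (simp add: expo_def)
    finally show "Suc (8 * expo k * h ^ 4) \<le> L" .
  qed
  have "Suc r \<le> 9 * h ^ 3" using h1 by (simp add: r_def Suc_le_eq)
  also have "\<dots> \<le> h * h ^ 3" using h1 by (intro mult_right_mono) auto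
  also have "\<dots> = h ^ 4" by (simp add: eval_nat_numeral)
  finally have "Suc r ^ k \<le> (h ^ 4) ^ k" by (intro power_mono) auto
  then have rk: "Suc r ^ k \<le> h ^ (4 * k)" by (simp add: power_mult)
  show "(k ^ 2) ^ (Suc r ^ k) \<le> N"
  proof (rule le)
    \<comment> \<open>The exponent becomes \<open>2 * k * Suc r ^ k\<close>, at most
      \<open>h ^ (4 * k + 1)\<close>; one more factor \<open>h\<close> makes the inequality
      strict.\<close>
    have "k ^ 2 \<le> (2 ^ k) ^ 2" by (intro power_mono) (auto intro: less_imp_le less_exp)
    then have "(k ^ 2) ^ (Suc r ^ k) \<le> ((2 ^ k) ^ 2) ^ (Suc r ^ k)" by (intro power_mono) auto
    also have "\<dots> = 2 ^ (2 * k * Suc r ^ k)" by (simp add: power_mult[symmetric] mult.commute mult.left_commute)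
    also have "\<dots> \<le> 2 ^ (h * h ^ (4 * k))" using rk h1 by (intro power_increasing mult_mono) auto
    finally show "(k ^ 2) ^ (Suc r ^ k) \<le> 2 ^ (h * h ^ (4 * k))" .
    have "Suc (h * h ^ (4 * k)) \<le> h * (h * h ^ (4 * k))" using h1 by (simp add: Suc_le_eq)
    also have "\<dots> = h ^ (4 * k + 2)" by simp
    also have "\<dots> \<le> L" by (rule pw) (use kb in \<open>simp add: expo_def\<close>)
    finally show "Suc (h * h ^ (4 * k)) \<le> L" .
  qed
  have "L - 1 < 2 ^ (L - 1)" by (rule less_exp)
  then have LN: "L \<le> N" using le[of "L - 1" "2 ^ (L - 1)"] L2 by linarith
  have "h ^ (4 * k) \<le> L" by (rule pw) (use kb in \<open>simp add: expo_def\<close>)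
  then show "Suc r ^ k \<le> N" using rk LN by linarith
  have "h ^ 1 \<le> L" by (rule pw) (simp add: expo_def)
  then show hN: "h \<le> N" "4 \<le> N" using LN h1 by auto
  have "k ^ 2 \<le> h ^ 2" using h1 by (intro power_mono) auto
  also have "\<dots> \<le> L" by (rule pw) (simp add: expo_def)
  finally show "k ^ 2 \<le> N" using LN by simp
qed

lemma length_svertices: "length (svertices k M) \<le> k ^ 2 * length M ^ 2"
  unfolding svertices_def
  by (rule order_trans[OF length_filter_le]) (simp add: length_concat comp_def sum_list_triv length_cells power2_eq_square)

lemma length_evertices:
  "length (evertices N k L r h) = h * (length (choices N [0..<r] [0..<Suc L]) * length (choices N (choices N [0..<k] [0..<Suc r]) (cells k)))"
  unfolding evertices_def by (simp add: length_concat comp_def sum_list_triv del: upt_Suc)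

text \<open>Truncation bounds each enumeration by \<open>N\<close>. The exponent 4 turns into the
  factor 4 that \<open>gap\<close> allows for the logarithm.\<close>

lemma length_vertices:
  assumes "k ^ 2 \<le> N" "length M \<le> N" "h \<le> N" "4 \<le> N"
  shows "length (vertices k M N L r h) \<le> N ^ 4"
proof -
  have c: "length (choices N A U) \<le> N" for A :: "'a list" and U :: "'b list" using length_choices[of N A U] assms(4) by simp
  have "k ^ 2 * length M ^ 2 \<le> N * N ^ 2" using assms by (intro mult_mono power_mono) auto
  then have "length (svertices k M) \<le> N * N ^ 2" using length_svertices order_trans by blast
  moreover have "length (evertices N k L r h) \<le> N * (N * N)"
    unfolding length_evertices by (intro mult_mono c assms) auto
  ultimately have "length (vertices k M N L r h) \<le> 2 + 2 * N ^ 3"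
    by (simp add: vertices_def power2_eq_square power3_eq_cube)
  also have "\<dots> \<le> 4 * N ^ 3" using one_le_power[of N 3] assms(4) by simp
  also have "\<dots> \<le> N * N ^ 3" using assms(4) by (rule mult_right_mono) simp
  finally show ?thesis by (simp add: eval_nat_numeral)
qed

text \<open>Raised to the power \<open>2 * K\<close>, the opposite inequality gives
  \<open>h ^ (2 * K) <= 4 * (h + 1) ^ K * b ^ (2 * K)\<close>. The right side is at most the
  \<open>K\<close>-th power of \<open>4 * (h + 1) * b ^ 2\<close>, which is smaller than
  \<open>h ^ 2\<close> since \<open>8 * b ^ 2 <= h\<close>. The 2 in the exponent provides the
  surplus that swallows \<open>b\<close>.\<close>

lemma gap:
  fixes b h K :: nat and x :: real
  assumes b: "1 \<le> b" and h: "8 * b ^ 2 \<le> h" and K: "1 \<le> K" and x: "1 \<le> x" "x \<le> 4 * real (Suc h ^ K)"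
  shows "x powr (1 / real (2 * K)) * real b < real h"
proof (rule ccontr)
  assume "\<not> ?thesis"
  then have "real h \<le> x powr (1 / real (2 * K)) * real b" by simp
  then have "real h ^ (2 * K) \<le> (x powr (1 / real (2 * K)) * real b) ^ (2 * K)" by (intro power_mono) auto
  also have "\<dots> = x * real b ^ (2 * K)" using x K by (simp add: power_mult_distrib powr_power)
  also have "\<dots> \<le> (4 * real (Suc h ^ K)) * real b ^ (2 * K)" using x by (intro mult_right_mono) auto
  also have "\<dots> = real (4 * Suc h ^ K * b ^ (2 * K))" by simp
  finally have "real (h ^ (2 * K)) \<le> real (4 * Suc h ^ K * b ^ (2 * K))" by simp
  then have 1: "h ^ (2 * K) \<le> 4 * Suc h ^ K * b ^ (2 * K)" by (simp only: of_nat_le_iff)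
  have b2: "1 \<le> b ^ 2" using b by simp
  then have h8: "8 \<le> h" using h by linarith
  have "4 * Suc h ^ K * b ^ (2 * K) = 4 * (Suc h * b ^ 2) ^ K" by (simp only: power_mult_distrib power_mult mult.assoc)
  also have "\<dots> \<le> 4 ^ K * (Suc h * b ^ 2) ^ K" using K self_le_power[of "4::nat" K] by (intro mult_right_mono) auto
  also have "\<dots> = (4 * (Suc h * b ^ 2)) ^ K" by (simp only: power_mult_distrib)
  also have "\<dots> < (h ^ 2) ^ K"
  proof (rule power_strict_mono)
    have "4 * (Suc h * b ^ 2) < 8 * h * b ^ 2" using h8 b by simp
    also have "\<dots> \<le> h * h" using h by (simp add: mult.assoc mult.left_commute)
    finally show "4 * (Suc h * b ^ 2) < h ^ 2" by (simp add: power2_eq_square)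
  qed (use K in auto)
  finally show False using 1 by (simp add: power_mult)
qed


section \<open>The clique algorithm and its running time\<close>

lemma nat_poly_bound: "\<exists>d. \<forall>n. poly (q :: nat poly) n \<le> (n + 2) ^ d"
proof -
  have "poly_bounded UNIV (\<lambda>n :: nat. n + 2) (poly q)"
  proof (induction q)
    case 0 then show ?case using poly_bounded_const[of UNIV "\<lambda>n :: nat. n + 2" 0] by (simp add: fun_eq_iff cong: if_cong)
  next
    case (pCons a q)
    have "poly_bounded UNIV (\<lambda>n :: nat. n + 2) (\<lambda>n. n)"
      by (rule poly_bounded_mono[OF poly_bounded_self]) auto
    then have "poly_bounded UNIV (\<lambda>n :: nat. n + 2) (\<lambda>n. a + n * poly q n)"
      by (intro poly_bounded_add poly_bounded_mult poly_bounded_const pCons.IH) auto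
    then show ?case by (simp add: fun_eq_iff)
  qed
  then show ?thesis unfolding poly_bounded_def by blast
qed

text \<open>The inner power and its cost are dominated by the outer one, so the double exponential
  is computed in time polynomial in its own value (and \<open>k\<close>).\<close>

lemma computes_pad: "\<exists>c. computes UNIV pad (\<lambda>k. (pad k + k + 2) ^ c)"
proof -
  define g where "g k = hmin k * expo k" for k
  have "PH g" unfolding g_def[abs_def] by (intro PH_intros PH_hmin PH_expo)
  then obtain a where a: "computes UNIV g (\<lambda>k. (hgt k + 2) ^ a)" unfolding PH_def by blast
  obtain c where c: "computes UNIV (\<lambda>n :: nat. (2::nat) ^ n) (\<lambda>n. (2 ^ n + n + 2) ^ c)" using computes_pow2 by blast
  let ?T = "\<lambda>k. ((hgt k + 2) ^ a + (2 ^ g k + g k + 2) ^ c) + (2 ^ (2 ^ g k) + 2 ^ g k + 2) ^ c"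
  have 1: "computes UNIV (\<lambda>k. (2 :: nat) ^ (2 ^ g k)) ?T"
    by (rule computes_compose[OF computes_compose[OF a c] c]) auto
  have p: "pad k = 2 ^ (2 ^ g k)" for k by (simp add: pad_def g_def)
  have "poly_bounded UNIV (\<lambda>k. pad k + k + 2) ?T"
  proof (rule poly_bounded_mono)
    let ?S = "\<lambda>k. pad k + k + 2"
    show "poly_bounded UNIV ?S (\<lambda>k. (?S k ^ a + (?S k + ?S k) ^ c) + (?S k + ?S k) ^ c)"
      by (intro poly_bounded_add poly_bounded_power poly_bounded_self) auto
    fix k
    have "g k \<le> 2 ^ g k" "(2 :: nat) ^ g k \<le> 2 ^ (2 ^ g k)" by (auto intro: less_imp_le less_exp)
    then have "2 ^ g k + g k + 2 \<le> ?S k + ?S k" "2 ^ (2 ^ g k) + 2 ^ g k + 2 \<le> ?S k + ?S k" "hgt k + 2 \<le> ?S k"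
      unfolding p hgt_nat by linarith+
    then show "?T k \<le> (?S k ^ a + (?S k + ?S k) ^ c) + (?S k + ?S k) ^ c"
      by (intro add_le_mono[OF add_le_mono[OF power_mono power_mono] power_mono]) simp_all
  qed
  then obtain b where "\<forall>k. ?T k \<le> (pad k + k + 2) ^ b" unfolding poly_bounded_def by blast
  then have "computes UNIV (\<lambda>k. (2 :: nat) ^ (2 ^ g k)) (\<lambda>k. (pad k + k + 2) ^ b)"
    by (intro computes_mono[OF 1]) auto
  then show ?thesis unfolding p[symmetric] by blast
qed

text \<open>Acceptance implies a clique for any output \<open>d\<close>, by soundness. Conversely a
  clique puts the domination number within the budget; then the guarantee applies, and
  \<open>gap\<close> bounds the returned set below \<open>h\<close>.\<close>

lemma clique_check_correct:
  fixes k m :: nat and E :: "nat set set"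
  defines "y \<equiv> ((k, matrix m E), pad k)"
  assumes G: "graph m E"
    and out: "domination_number (length (in_verts y)) (list_graph adj (in_verts y)) \<le> budget k \<Longrightarrow>
      \<exists>S. encodes_vertex_set d S \<and> dominating_set (length (in_verts y)) (list_graph adj (in_verts y)) S \<and>
        real (card S) \<le> log 2 (real (length (in_verts y))) powr (1 / real (2 * expo k)) * real (budget k)"
  shows "check (y, d) \<longleftrightarrow> (\<exists>S. clique m E S \<and> card S = k)"
proof
  define N where "N = pad k + m"
  let ?L = "nbits N"
  let ?h = "hsize k ?L"
  let ?r = "8 * ?h ^ 3"
  note par = parameters[where k = k and m = m, folded N_def]
  have inN: "in_N y = N" by (simp add: in_N_def y_def N_def)
  have h: "in_h y = ?h" by (simp add: in_h_def inN) (simp add: y_def)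
  have vs: "in_verts y = vertices k (matrix m E) N ?L ?r ?h"
    unfolding in_verts_def inN h by (simp add: y_def)
  let ?n = "length (in_verts y)" and ?E = "list_graph adj (in_verts y)"
  {
    assume "check (y, d)"
    then obtain D where "dominating_set ?n ?E D" "card D < ?h" unfolding check_iff h by blast
    then show "\<exists>S. clique m E S \<and> card S = k"
      unfolding vs by (intro reduction_sound[OF refl G par(3,4,2) refl]) auto
  next
    assume "\<exists>S. clique m E S \<and> card S = k"
    then obtain S where "clique m E S" "card S = k" by blast
    from reduction_complete[OF refl this par(5)]
    obtain D where D: "dominating_set ?n ?E D" "card D \<le> budget k" unfolding vs budget_def by blast
    have "finite {S. dominating_set ?n ?E S}"
      by (rule finite_subset[of _ "Pow {..<?n}"]) (auto simp: dominating_set_def)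
    then have "domination_number ?n ?E \<le> card D"
      unfolding domination_number_def using D(1) by (intro Min_le) auto
    with D out obtain S where S: "encodes_vertex_set d S" "dominating_set ?n ?E S"
      "real (card S) \<le> log 2 (real ?n) powr (1 / real (2 * expo k)) * real (budget k)" by auto
    have n2: "2 \<le> ?n" by (simp add: vs vertices_def)
    have n4: "?n \<le> N ^ 4" unfolding vs by (rule length_vertices) (use par in \<open>simp_all add: N_def\<close>)
    \<comment> \<open>The chain compares the graph size with \<open>h\<close>: its logarithm is at
      most \<open>4 * log N\<close>, then \<open>4 * L\<close>, then
      \<open>4 * (h + 1) ^ expo k\<close>.\<close>
    have "log 2 (real ?n) \<le> log 2 (real (N ^ 4))" 
    proof (rule log_mono)
      show "real ?n \<le> real (N ^ 4)" using n4 by (simp only: of_nat_le_iff)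
    qed (use n2 in auto)
    also have "\<dots> = 4 * log 2 (real N)" using par(8) by (simp add: log_nat_power)
    also have "\<dots> \<le> 4 * log 2 (real (2 ^ ?L))" 
    proof (intro mult_left_mono log_mono)
      show "real N \<le> real (2 ^ ?L)" using par(9) by (simp only: of_nat_le_iff less_imp_le)
    qed (use par(8) in auto)
    also have "\<dots> = 4 * real ?L" by simp
    also have "\<dots> \<le> 4 * real (Suc ?h ^ expo k)" using par(10) by (simp del: of_nat_power power_Suc)
    finally have u: "log 2 (real ?n) \<le> 4 * real (Suc ?h ^ expo k)" .
    have l: "1 \<le> log 2 (real ?n)" using log_mono[of 2 2 "real ?n"] n2 by simp
    have "log 2 (real ?n) powr (1 / real (2 * expo k)) * real (budget k) < real ?h"
      by (rule gap[OF _ _ _ l u]) (use par(1) in \<open>auto simp: budget_def hmin_def expo_def\<close>)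
    then have "card S < in_h y" using S(3) h by linarith
    moreover have "S = set (out_list d) \<inter> {..<?n}"
      using S(2) set_out_list[OF S(1)] unfolding dominating_set_def by auto
    ultimately show "check (y, d)" unfolding check_iff using S(2) by blast
  }
qed

text \<open>The new program pads the input, builds the instance, runs the approximation program and
  verifies its answer. All quantities are bounded by powers of \<open>A(k) * (m + 2)\<close>, with
  everything that depends on \<open>k\<close> alone collected in \<open>A\<close>; such a power
  splits into a computable factor and a polynomial in \<open>m\<close>.\<close>

lemma clique_solver:
  assumes T: "computable T"
    and P: "approximates_dominating_set P T (\<lambda>n k. log 2 (real n) powr (1 / poly [:16, 12:] (real k)))"
  shows "\<exists>T' P'. computable T' \<and> solves_clique P' T'"
proof -
  let ?f = "\<lambda>n k. log 2 (real n) powr (1 / poly [:16, 12:] (real k))"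
  obtain q where q: "\<And>n E k. n \<ge> 2 \<Longrightarrow> graph n E \<Longrightarrow> k \<ge> 1 \<Longrightarrow>
     \<exists>t out. t \<le> T k * poly q n \<and> runs P (enc_instance n E k) t out \<and>
           (domination_number n E \<le> k \<longrightarrow>
              (\<exists>S. encodes_vertex_set out S \<and> dominating_set n E S \<and> real (card S) \<le> ?f n k * real k))"
    using P unfolding approximates_dominating_set_def by blast
  have p: "poly [:16, 12:] (real (budget k)) = real (2 * expo k)" for k by (simp add: expo_def)
  let ?X = "{x :: nat \<times> nat \<times> nat set set. graph (fst (snd x)) (snd (snd x))}"
  define i where "i x = (fst x, matrix (fst (snd x)) (snd (snd x)))" for x :: "nat \<times> nat \<times> nat set set"
  define y where "y x = (i x, pad (fst x))" for x
  define n where "n x = length (in_verts (y x))" for x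
  let ?E = "\<lambda>x. list_graph adj (in_verts (y x))"
  have n2: "2 \<le> n x" for x by (simp add: n_def in_verts_def vertices_def)
  have inst: "enc_instance (n x) (?E x) (budget (fst x)) = enc (inst (y x))" for x
    by (simp add: enc_instance_def enc_list_graph[OF adj_sym] inst_def enc_nat_def y_def i_def n_def)
  \<comment> \<open>The constructed graph is a legitimate instance for every \<open>E\<close>, so
    time and output can be chosen for all \<open>x\<close>; only correctness needs the input to be a
    graph.\<close>
  have "\<forall>x. \<exists>t out. t \<le> T (budget (fst x)) * poly q (n x) \<and> runs P (enc (inst (y x))) t out \<and>
     (domination_number (n x) (?E x) \<le> budget (fst x) \<longrightarrow>
        (\<exists>S. encodes_vertex_set out S \<and> dominating_set (n x) (?E x) S \<and>
           real (card S) \<le> ?f (n x) (budget (fst x)) * real (budget (fst x))))"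
    unfolding inst[symmetric] by (intro allI q n2) (simp_all add: n_def graph_list_graph[OF adj_irrefl] budget_def)
  from choice[OF this] obtain t where
    "\<forall>x. \<exists>out. t x \<le> T (budget (fst x)) * poly q (n x) \<and> runs P (enc (inst (y x))) (t x) out \<and>
     (domination_number (n x) (?E x) \<le> budget (fst x) \<longrightarrow>
        (\<exists>S. encodes_vertex_set out S \<and> dominating_set (n x) (?E x) S \<and>
           real (card S) \<le> ?f (n x) (budget (fst x)) * real (budget (fst x))))" ..
  from choice[OF this] obtain out where
    "\<forall>x. t x \<le> T (budget (fst x)) * poly q (n x) \<and> runs P (enc (inst (y x))) (t x) (out x) \<and>
     (domination_number (n x) (?E x) \<le> budget (fst x) \<longrightarrow>
        (\<exists>S. encodes_vertex_set (out x) S \<and> dominating_set (n x) (?E x) S \<and>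
           real (card S) \<le> ?f (n x) (budget (fst x)) * real (budget (fst x))))" ..
  note out = spec[OF this]
  note to = conjunct1[OF out] conjunct1[OF conjunct2[OF out]] mp[OF conjunct2[OF conjunct2[OF out]]]
  have correct: "check (y x, out x) \<longleftrightarrow> (\<exists>S. clique (fst (snd x)) (snd (snd x)) S \<and> card S = fst x)" if "x \<in> ?X" for x
    unfolding y_def i_def
  proof (rule clique_check_correct)
    show "graph (fst (snd x)) (snd (snd x))" using that by simp
  qed (rule to(3)[of x, unfolded n_def y_def i_def p])

  obtain c where c: "computes UNIV pad (\<lambda>k. (pad k + k + 2) ^ c)" using computes_pad by blast
  obtain T0 where T0: "computes UNIV (\<lambda>z :: nat \<times> bool list list. z) T0" "pb T0" using PH_id PHE by blast
  obtain Tf where Tf: "computes UNIV (\<lambda>z :: nat \<times> bool list list. fst z) Tf" "pb Tf" using PH_fst[OF PH_id] PHE by blast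
  have 1: "computes UNIV (\<lambda>z :: nat \<times> bool list list. (z, pad (fst z))) (\<lambda>z. T0 z + (Tf z + (pad (fst z) + fst z + 2) ^ c) + 4)"
    by (rule computes_Pair[OF T0(1) computes_compose[OF Tf(1) c]]) auto
  have "PH (\<lambda>z. (z, inst z))" by (intro PH_Pair PH_id PH_inst)
  then obtain T2 where T2: "computes UNIV (\<lambda>z. (z, inst z)) T2" "pb T2" using PHE by blast
  obtain T4 where T4: "computes UNIV check T4" "pb T4" using PH_check PHE by blast

  define N where "N = Suc (vbound P)"
  obtain Q1 N1 where Q1: "\<And>x. maps Q1 N1 (enc (i x)) (T0 (i x) + (Tf (i x) + (pad (fst x) + fst x + 2) ^ c) + 4) (enc (y x))"
    using 1 unfolding computes_def y_def by (auto simp: i_def)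
  obtain Q2 N2 where Q2: "\<And>x. maps Q2 N2 (enc (y x)) (T2 (y x)) (enc (y x, inst (y x)))"
    using T2(1) unfolding computes_def by blast
  \<comment> \<open>Verification needs the input besides the answer, so the given program is applied
    to the second component while the first is kept.\<close>
  let ?Q3 = "pair_prog (SetLeft 0 0) (Seq (SetRight 0 0) (Seq (clear N) P)) N"
  have Q3: "maps ?Q3 (N + 2) (enc (y x, inst (y x))) (1 + (1 + (t x + N + 1)) + 4) (enc (y x, out x))" for x
  proof -
    have l: "maps (SetLeft 0 0) 0 (enc (y x, inst (y x))) 1 (enc (y x))"
      using maps_SetLeft[of "enc (y x, inst (y x))"] by simp
    have r: "maps (SetRight 0 0) 0 (enc (y x, inst (y x))) 1 (enc (inst (y x)))"
      using maps_SetRight[of "enc (y x, inst (y x))"] by simp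
    have R: "maps (Seq (clear N) P) N (enc (inst (y x))) (t x + N + 1) (out x)"
      by (rule runs_maps[OF to(2)]) (simp_all add: N_def)
    have "enc (y x, out x) = Node (enc (y x)) (out x)" by (simp add: enc_dtree_def)
    then show ?thesis using maps_pair[OF l maps_seq[OF r R], of N] by (simp add: N_def)
  qed
  obtain Q4 N4 where Q4: "\<And>x. maps Q4 N4 (enc (y x, out x)) (T4 (y x, out x)) (enc (check (y x, out x)))"
    using T4(1) unfolding computes_def by blast
  define Q where "Q = Seq Q1 (Seq Q2 (Seq ?Q3 Q4))"
  define Tot where "Tot x = (T0 (i x) + (Tf (i x) + (pad (fst x) + fst x + 2) ^ c) + 4) +
     (T2 (y x) + ((1 + (1 + (t x + N + 1)) + 4) + T4 (y x, out x)))" for x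
  have Q: "\<exists>u\<le>Tot x. runs Q (enc (i x)) u (enc (check (y x, out x)))" for x
    unfolding Q_def Tot_def by (rule maps_runs[OF maps_seq[OF Q1 maps_seq[OF Q2 maps_seq[OF Q3 Q4]]]])

  \<comment> \<open>The product dominates both the size of the padding and the time factor at the
    new parameter; the added twos keep each factor at least 2.\<close>
  define A where "A k = (pad k + k + 2) * (T (budget k) + 2)" for k
  let ?S = "\<lambda>x :: nat \<times> nat \<times> nat set set. A (fst x) * (fst (snd x) + 2)"
  have S2: "2 \<le> ?S x" and Sm: "fst (snd x) + 2 \<le> ?S x" and Sk: "pad (fst x) + fst x + 2 \<le> ?S x"
    and ST: "T (budget (fst x)) + 2 \<le> ?S x" for x
  proof -
    have "1 \<le> A (fst x)" "pad (fst x) + fst x + 2 \<le> A (fst x)" "T (budget (fst x)) + 2 \<le> A (fst x)"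
      by (simp_all add: A_def)
    moreover have "a \<le> A (fst x) \<Longrightarrow> a \<le> ?S x" for a by (simp add: trans_le_add2)
    moreover have "1 * (fst (snd x) + 2) \<le> ?S x" using calculation(1) by (rule mult_right_mono) simp
    ultimately show "2 \<le> ?S x" "fst (snd x) + 2 \<le> ?S x" "pad (fst x) + fst x + 2 \<le> ?S x" "T (budget (fst x)) + 2 \<le> ?S x"
      by auto
  qed
  let ?pb = "poly_bounded UNIV ?S"
  note S = poly_bounded_self[of UNIV ?S, OF S2]
  note pc = poly_bounded_const[of UNIV ?S, OF S2]
  note pbi = poly_bounded_add poly_bounded_mult poly_bounded_power pc
  have bk: "?pb (\<lambda>x. fst x)" "?pb (\<lambda>x. pad (fst x))" by (rule poly_bounded_mono[OF S], rule order_trans[OF _ Sk], simp)+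
  have bm: "?pb (\<lambda>x. fst (snd x))" by (rule poly_bounded_mono[OF S], rule order_trans[OF _ Sm], simp)
  have bT: "?pb (\<lambda>x. T (budget (fst x)))" by (rule poly_bounded_mono[OF S], rule order_trans[OF _ ST], simp)
  have bi: "?pb (\<lambda>x. hgt (i x))"
  proof (rule poly_bounded_mono)
    show "?pb (\<lambda>x. Suc (fst x + (fst (snd x) + (fst (snd x) + 1))))"
      unfolding Suc_eq_plus1 by (intro pbi bk bm)
    fix x :: "nat \<times> nat \<times> nat set set"
    have "hgt (matrix a E) \<le> a + (a + 1)" for a E
    proof -
      have "hgt (matrix a E) \<le> length (matrix a E) + (a + 1)"
      proof (rule hgt_le)
        fix l assume "l \<in> set (matrix a E)"
        then have "length l = a" by (auto simp: matrix_def)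
        then show "hgt l \<le> a + 1" using hgt_le[of l 1] hgt_bool by auto
      qed
      then show ?thesis by simp
    qed
    then have "hgt (matrix (fst (snd x)) (snd (snd x))) \<le> fst (snd x) + (fst (snd x) + 1)" .
    then show "hgt (i x) \<le> Suc (fst x + (fst (snd x) + (fst (snd x) + 1)))"
      unfolding i_def by (intro order_trans[OF hgt_pair_le]) simp
  qed
  have bsy: "?pb (\<lambda>x. hgt (y x))"
  proof (rule poly_bounded_mono)
    show "?pb (\<lambda>x. Suc (hgt (i x) + pad (fst x)))" unfolding Suc_eq_plus1 by (intro pbi bi bk)
  qed (simp add: y_def)
  have binst: "?pb (\<lambda>x. hgt (inst (y x)))" by (rule poly_bounded_compose[OF PH_pb[OF PH_inst] bsy])
  have bn: "?pb n"
  proof (rule poly_bounded_mono[OF binst])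
    fix x
    have "n x \<le> hgt (snd (inst (y x)))" using length_le_hgt[of "snd (inst (y x))"] by (simp add: n_def inst_def)
    also have "\<dots> \<le> hgt (inst (y x))" by (simp add: enc_prod_def)
    finally show "n x \<le> hgt (inst (y x))" .
  qed
  obtain d where d: "\<And>n. poly q n \<le> (n + 2) ^ d" using nat_poly_bound by blast
  have bt: "?pb t"
  proof (rule poly_bounded_mono)
    show "?pb (\<lambda>x. T (budget (fst x)) * (n x + 2) ^ d)" by (intro pbi bT bn)
    show "t x \<le> T (budget (fst x)) * (n x + 2) ^ d" for x using to(1)[of x] mult_le_mono2[OF d] order_trans by blast
  qed
  \<comment> \<open>Nothing is known about the shape of the output, but its height is limited by the
    time spent producing it.\<close>
  have bout: "?pb (\<lambda>x. hgt (y x, out x))"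
  proof (rule poly_bounded_mono)
    show "?pb (\<lambda>x. hgt (y x, inst (y x)) + (1 + (1 + (t x + N + 1)) + 4))"
      by (intro pbi bt poly_bounded_compose[OF PH_pb[OF PH_Pair[OF PH_id PH_inst]] bsy])
  qed (rule maps_height[OF Q3])
  have "?pb Tot" unfolding Tot_def[abs_def]
    by (intro pbi poly_bounded_compose[OF T0(2) bi] poly_bounded_compose[OF Tf(2) bi] bk bt
        poly_bounded_compose[OF T2(2) bsy] poly_bounded_compose[OF T4(2) bout])
  then obtain C where C: "\<And>x. Tot x \<le> ?S x ^ C" unfolding poly_bounded_def by blast

  \<comment> \<open>The hypothesis excludes only computable time bounds, so computability of
    \<open>A\<close> has to be derived from that of \<open>T\<close> and of the padding.\<close>
  have "Cmp (\<lambda>k. A k ^ C)" unfolding A_def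
    by (intro Cmp_power Cmp_mult Cmp_add Cmp_compose[OF computable_Cmp[OF T]] PH_Cmp[OF PH_budget[OF PH_id]]
        PH_Cmp[OF PH_id] PH_Cmp[OF PH_const]) (use c in \<open>auto simp: Cmp_def\<close>)
  then have "computable (\<lambda>k. A k ^ C)" by (rule Cmp_computable)
  moreover have "solves_clique Q (\<lambda>k. A k ^ C)"
    unfolding solves_clique_def
  proof (intro exI[of _ "[:2, 1:] ^ C"] allI impI)
    fix m :: nat and E :: "nat set set" and k :: nat assume G: "graph m E"
    let ?x = "(k, m, E)"
    obtain u where u: "u \<le> Tot ?x" "runs Q (enc (i ?x)) u (enc (check (y ?x, out ?x)))" using Q by blast
    have "u \<le> A k ^ C * poly ([:2, 1:] ^ C) m"
    proof -
      have "poly ([:2, 1:] ^ C) m = (m + 2) ^ C" by (simp add: poly_power add.commute)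
      then show ?thesis using order_trans[OF u(1) C[of ?x]] by (simp only: power_mult_distrib fst_conv snd_conv)
    qed
    moreover have "enc (i ?x) = enc_instance m E k" by (simp add: i_def enc_instance_def enc_nat_def enc_matrix)
    moreover have "enc (check (y ?x, out ?x)) = enc_bool (\<exists>S. clique m E S \<and> card S = k)"
      using correct[of ?x] G by (simp add: enc_bool_def)
    ultimately show "\<exists>u. u \<le> A k ^ C * poly ([:2, 1:] ^ C) m \<and> runs Q (enc_instance m E k) u (enc_bool (\<exists>S. clique m E S \<and> card S = k))"
      using u(2) by auto
  qed
  ultimately show ?thesis by blast
qed

theorem theorem1p3:
  assumes "W1_neq_FPT"
  shows "\<exists>p :: real poly. (\<forall>k::nat. k \<ge> 1 \<longrightarrow> poly p (real k) \<ge> 1) \<and>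
    (\<forall>T :: nat \<Rightarrow> nat. computable T \<longrightarrow>
      \<not> (\<exists>P. approximates_dominating_set P T
               (\<lambda>n k. log 2 (real n) powr (1 / poly p (real k)))))"
proof (intro exI[of _ "[:16, 12:]"] conjI allI impI notI)
  fix T assume T: "computable T"
    "\<exists>P. approximates_dominating_set P T (\<lambda>n k. log 2 (real n) powr (1 / poly [:16, 12:] (real k)))"
  then show False using clique_solver assms unfolding W1_neq_FPT_def by blast
qed simp

end
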